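(* A regular tree set $\tau$ is profinite if and only if it is chain-complete, splittable and star-finite.
   Context: A separation system $(\vec S,\le,{}^* )$ is a poset with an order-reversing involution $\vec s\mapsto\overleftarrow s$; $s=\{\vec s,\overleftarrow s\}$ is the unoriented separation with orientations $\vec s,\overleftarrow s$. $\vec s$ is degenerate if $\vec s=\overleftarrow s$, small if $\vec s\le\overleftarrow s$; a separation system is regular if it has no small element. Unoriented $r,s$ are nested if some orientation of $r$ is $\le$ some orientation of $s$. $\vec r$ is trivial if there is $s$ with $\vec r<\vec s$ and $\vec r<\overleftarrow s$ (strictly). A tree set is a separation system in which any two separations are nested and which has no degenerate and no trivial elements. Write $\vec r\lneqq\vec s$ if $\vec r\le\vec s$ and $r\ne s$. An orientation of a separation system is a set $O$ containing exactly one orientation of every unoriented separation; it is consistent if there are no $\vec r,\vec s\in O$ with $r\ne s$ and $\overleftarrow r\le\vec s$. A star is a set $\sigma$ of oriented separations with $\vec r\le\overleftarrow s$ for all distinct $\vec r,\vec s\in\sigma$. A set $\sigma$ is a splitting star of $\tau$ if $\tau$ has a consistent orientation $O$ such that every element of $O$ lies below some element of $\sigma$ and $\sigma$ is exactly the set of maximal elements of $O$. $\tau$ is chain-complete if every non-empty chain in $\tau$ has a supremum in $\tau$. $\tau$ is splittable if for all $\vec r,\vec s\in\tau$ with $\vec r\lneqq\vec s$ there are $\vec r',\vec s'\in\tau$ with $\vec r\le\vec r'\lneqq\vec s'\le\vec s$ such that $\vec r'$ and $\overleftarrow{s'}$ lie in a common splitting star of $\tau$. $\tau$ is star-finite if it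 contains no infinite star. Homomorphisms of separation systems commute with the involutions and preserve $\le$; isomorphisms are bijective homomorphisms with homomorphic inverse. An inverse system of finite separation systems is a family $(\vec S_p)_{p\in P}$ over a directed poset $P$ with homomorphisms $f_{qp}\colon\vec S_q\to\vec S_p$ ($p\le q$), $f_{pp}=\mathrm{id}$, $f_{qp}f_{tq}=f_{tp}$; its inverse limit is the set of compatible families $(\vec s_p)$ ($f_{qp}(\vec s_q)=\vec s_p$) with coordinatewise order and involution. A separation system is profinite if it is isomorphic to such an inverse limit. *)

theory Defs
  imports "HOL-Library.FuncSet"
begin

text \<open>
  A separation system is given by its set of (oriented) separations, its order as a relation on that
  set, and its involution \<open>flip\<close>; only the values of \<open>flip\<close> on \<open>seps\<close> matter.
\<close>

record 'a sepsys =
  seps :: "'a set"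
  le :: "('a \<times> 'a) set"
  flip :: "'a \<Rightarrow> 'a"

definition separation_system :: "'a sepsys \<Rightarrow> bool" where
  "separation_system S \<longleftrightarrow>
     partial_order_on (seps S) (le S) \<and>
     (\<forall>s\<in>seps S. flip S s \<in> seps S \<and> flip S (flip S s) = s) \<and>
     (\<forall>r s. (r, s) \<in> le S \<longrightarrow> (flip S s, flip S r) \<in> le S)"

definition unoriented :: "'a sepsys \<Rightarrow> 'a \<Rightarrow> 'a set" where
  "unoriented S s = {s, flip S s}"

definition sless :: "'a sepsys \<Rightarrow> 'a \<Rightarrow> 'a \<Rightarrow> bool" where
  "sless S r s \<longleftrightarrow> (r, s) \<in> le S \<and> r \<noteq> s"

definition lneqq :: "'a sepsys \<Rightarrow> 'a \<Rightarrow> 'a \<Rightarrow> bool" where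
  "lneqq S r s \<longleftrightarrow> (r, s) \<in> le S \<and> unoriented S r \<noteq> unoriented S s"

definition degenerate :: "'a sepsys \<Rightarrow> 'a \<Rightarrow> bool" where
  "degenerate S s \<longleftrightarrow> s = flip S s"

definition small :: "'a sepsys \<Rightarrow> 'a \<Rightarrow> bool" where
  "small S s \<longleftrightarrow> (s, flip S s) \<in> le S"

definition trivial :: "'a sepsys \<Rightarrow> 'a \<Rightarrow> bool" where
  "trivial S r \<longleftrightarrow> (\<exists>s\<in>seps S. sless S r s \<and> sless S r (flip S s))"

definition nested :: "'a sepsys \<Rightarrow> 'a \<Rightarrow> 'a \<Rightarrow> bool" where
  "nested S r s \<longleftrightarrow> (\<exists>r'\<in>unoriented S r. \<exists>s'\<in>unoriented S s. (r', s') \<in> le S)"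

definition regular :: "'a sepsys \<Rightarrow> bool" where
  "regular S \<longleftrightarrow> (\<forall>s\<in>seps S. \<not> small S s)"

definition tree_set :: "'a sepsys \<Rightarrow> bool" where
  "tree_set S \<longleftrightarrow>
     separation_system S \<and>
     (\<forall>r\<in>seps S. \<forall>s\<in>seps S. nested S r s) \<and>
     (\<forall>s\<in>seps S. \<not> degenerate S s \<and> \<not> trivial S s)"

definition orientation :: "'a sepsys \<Rightarrow> 'a set \<Rightarrow> bool" where
  "orientation S Or \<longleftrightarrow> Or \<subseteq> seps S \<and> (\<forall>s\<in>seps S. \<exists>!r. r \<in> Or \<and> r \<in> unoriented S s)"

definition consistent :: "'a sepsys \<Rightarrow> 'a set \<Rightarrow> bool" where
  "consistent S Or \<longleftrightarrow>
     \<not> (\<exists>r\<in>Or. \<exists>s\<in>Or. unoriented S r \<noteq> unoriented S s \<and> (flip S r, s) \<in> le S)"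

definition star :: "'a sepsys \<Rightarrow> 'a set \<Rightarrow> bool" where
  "star S \<sigma> \<longleftrightarrow> \<sigma> \<subseteq> seps S \<and> (\<forall>r\<in>\<sigma>. \<forall>s\<in>\<sigma>. r \<noteq> s \<longrightarrow> (r, flip S s) \<in> le S)"

definition maximal_elements :: "'a sepsys \<Rightarrow> 'a set \<Rightarrow> 'a set" where
  "maximal_elements S A = {m\<in>A. \<not> (\<exists>x\<in>A. sless S m x)}"

definition splitting_star :: "'a sepsys \<Rightarrow> 'a set \<Rightarrow> bool" where
  "splitting_star S \<sigma> \<longleftrightarrow>
     (\<exists>Or. orientation S Or \<and> consistent S Or \<and>
           (\<forall>r\<in>Or. \<exists>s\<in>\<sigma>. (r, s) \<in> le S) \<and> \<sigma> = maximal_elements S Or)"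

definition is_supremum :: "'a sepsys \<Rightarrow> 'a set \<Rightarrow> 'a \<Rightarrow> bool" where
  "is_supremum S C s \<longleftrightarrow>
     s \<in> seps S \<and> (\<forall>c\<in>C. (c, s) \<in> le S) \<and>
     (\<forall>u\<in>seps S. (\<forall>c\<in>C. (c, u) \<in> le S) \<longrightarrow> (s, u) \<in> le S)"

definition chain_complete :: "'a sepsys \<Rightarrow> bool" where
  "chain_complete S \<longleftrightarrow>
     (\<forall>C. C \<subseteq> seps S \<and> C \<in> Chains (le S) \<and> C \<noteq> {} \<longrightarrow> (\<exists>s. is_supremum S C s))"

definition splittable :: "'a sepsys \<Rightarrow> bool" where
  "splittable S \<longleftrightarrow>
     (\<forall>r\<in>seps S. \<forall>s\<in>seps S. lneqq S r s \<longrightarrow>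
        (\<exists>r'\<in>seps S. \<exists>s'\<in>seps S.
           (r, r') \<in> le S \<and> lneqq S r' s' \<and> (s', s) \<in> le S \<and>
           (\<exists>\<sigma>. splitting_star S \<sigma> \<and> r' \<in> \<sigma> \<and> flip S s' \<in> \<sigma>)))"

definition star_finite :: "'a sepsys \<Rightarrow> bool" where
  "star_finite S \<longleftrightarrow> \<not> (\<exists>\<sigma>. star S \<sigma> \<and> infinite \<sigma>)"

definition homomorphism :: "'a sepsys \<Rightarrow> 'b sepsys \<Rightarrow> ('a \<Rightarrow> 'b) \<Rightarrow> bool" where
  "homomorphism S T f \<longleftrightarrow>
     f \<in> seps S \<rightarrow> seps T \<and>
     (\<forall>s\<in>seps S. f (flip S s) = flip T (f s)) \<and>
     (\<forall>r\<in>seps S. \<forall>s\<in>seps S. (r, s) \<in> le S \<longrightarrow> (f r, f s) \<in> le T)"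

definition isomorphism :: "'a sepsys \<Rightarrow> 'b sepsys \<Rightarrow> ('a \<Rightarrow> 'b) \<Rightarrow> bool" where
  "isomorphism S T f \<longleftrightarrow>
     bij_betw f (seps S) (seps T) \<and> homomorphism S T f \<and>
     homomorphism T S (inv_into (seps S) f)"

definition isomorphic :: "'a sepsys \<Rightarrow> 'b sepsys \<Rightarrow> bool" where
  "isomorphic S T \<longleftrightarrow> (\<exists>f. isomorphism S T f)"

definition directed_poset :: "'i set \<Rightarrow> ('i \<times> 'i) set \<Rightarrow> bool" where
  "directed_poset P R \<longleftrightarrow>
     partial_order_on P R \<and> P \<noteq> {} \<and> (\<forall>p\<in>P. \<forall>q\<in>P. \<exists>t\<in>P. (p, t) \<in> R \<and> (q, t) \<in> R)"

text \<open>For \<open>(p, q) \<in> R\<close>, i.e. \<open>p \<le> q\<close>, the bonding map \<open>f q p\<close> goes from \<open>D q\<close> to \<open>D p\<close>.\<close>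

definition finite_inverse_system ::
    "'i set \<Rightarrow> ('i \<times> 'i) set \<Rightarrow> ('i \<Rightarrow> 'e sepsys) \<Rightarrow> ('i \<Rightarrow> 'i \<Rightarrow> 'e \<Rightarrow> 'e) \<Rightarrow> bool" where
  "finite_inverse_system P R D f \<longleftrightarrow>
     directed_poset P R \<and>
     (\<forall>p\<in>P. separation_system (D p) \<and> finite (seps (D p))) \<and>
     (\<forall>p q. (p, q) \<in> R \<longrightarrow> homomorphism (D q) (D p) (f q p)) \<and>
     (\<forall>p\<in>P. \<forall>s\<in>seps (D p). f p p s = s) \<and>
     (\<forall>p q t. (p, q) \<in> R \<longrightarrow> (q, t) \<in> R \<longrightarrow> (\<forall>s\<in>seps (D t). f q p (f t q s) = f t p s))"

definition compatible_families ::
    "'i set \<Rightarrow> ('i \<times> 'i) set \<Rightarrow> ('i \<Rightarrow> 'e sepsys) \<Rightarrow> ('i \<Rightarrow> 'i \<Rightarrow> 'e \<Rightarrow> 'e) \<Rightarrow> ('i \<Rightarrow> 'e) set" where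
  "compatible_families P R D f =
     {x \<in> (\<Pi>\<^sub>E p\<in>P. seps (D p)). \<forall>p q. (p, q) \<in> R \<longrightarrow> f q p (x q) = x p}"

definition inverse_limit ::
    "'i set \<Rightarrow> ('i \<times> 'i) set \<Rightarrow> ('i \<Rightarrow> 'e sepsys) \<Rightarrow> ('i \<Rightarrow> 'i \<Rightarrow> 'e \<Rightarrow> 'e) \<Rightarrow> ('i \<Rightarrow> 'e) sepsys" where
  "inverse_limit P R D f =
     \<lparr>seps = compatible_families P R D f,
      le = {(x, y). x \<in> compatible_families P R D f \<and> y \<in> compatible_families P R D f \<and>
                    (\<forall>p\<in>P. (x p, y p) \<in> le (D p))},
      flip = (\<lambda>x. \<lambda>p\<in>P. flip (D p) (x p))\<rparr>"

text \<open>
  HOL cannot quantify over the types of the indices and of the elements of the finite separation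
  systems, so the definition fixes both. This is no restriction: the lemma \<open>profiniteI\<close> below says
  that a separation system isomorphic to an inverse limit of finite separation systems over
  arbitrary types is \<open>profinite\<close>. (The index \<open>p\<close> is replaced by the preorder that the projection
  to \<open>D p\<close> induces on \<open>S\<close>.)
\<close>

definition profinite :: "'a sepsys \<Rightarrow> bool" where
  "profinite S \<longleftrightarrow>
     (\<exists>(P :: ('a \<times> 'a) set set) R (D :: ('a \<times> 'a) set \<Rightarrow> nat sepsys) f.
        finite_inverse_system P R D f \<and> isomorphic S (inverse_limit P R D f))"

lemma profiniteI:
  fixes S :: "'a sepsys" and P :: "'i set" and D :: "'i \<Rightarrow> 'e sepsys"
  assumes S: "separation_system S"
    and sys: "finite_inverse_system P R D f"
    and iso: "isomorphic S (inverse_limit P R D f)"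
  shows "profinite S"
proof -
  let ?X = "seps S"
  let ?L = "inverse_limit P R D f"
  obtain \<phi> where \<phi>: "isomorphism S ?L \<phi>"
    using iso by (auto simp: isomorphic_def)
  have bij: "bij_betw \<phi> ?X (compatible_families P R D f)"
    using \<phi> by (simp add: isomorphism_def inverse_limit_def)
  have \<phi>L: "\<phi> x \<in> compatible_families P R D f" if "x \<in> ?X" for x
    using bij that by (auto simp: bij_betw_def)
  have \<phi>D: "\<phi> x p \<in> seps (D p)" if "x \<in> ?X" "p \<in> P" for x p
    using \<phi>L[OF that(1)] that(2) by (auto simp: compatible_families_def)
  have \<phi>f: "f q p (\<phi> x q) = \<phi> x p" if "x \<in> ?X" "(p, q) \<in> R" for x p q
    using \<phi>L[OF that(1)] that(2) by (auto simp: compatible_families_def)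
  have \<phi>flip: "\<phi> (flip S x) p = flip (D p) (\<phi> x p)" if "x \<in> ?X" "p \<in> P" for x p
    using \<phi> that by (simp add: isomorphism_def homomorphism_def inverse_limit_def)
  have po: "partial_order_on ?X (le S)"
    and flipX: "\<And>x. x \<in> ?X \<Longrightarrow> flip S x \<in> ?X"
    and flip2: "\<And>x. x \<in> ?X \<Longrightarrow> flip S (flip S x) = x"
    using S by (auto simp: separation_system_def)
  have leX: "le S \<subseteq> ?X \<times> ?X"
    using po by (auto simp: partial_order_on_def preorder_on_def)
  have \<phi>le: "(x, y) \<in> le S \<longleftrightarrow> (\<forall>p\<in>P. (\<phi> x p, \<phi> y p) \<in> le (D p))" if "x \<in> ?X" "y \<in> ?X" for x y
  proof
    assume "(x, y) \<in> le S"
    then have "(\<phi> x, \<phi> y) \<in> le ?L"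
      using \<phi> that by (simp add: isomorphism_def homomorphism_def)
    then show "\<forall>p\<in>P. (\<phi> x p, \<phi> y p) \<in> le (D p)"
      by (simp add: inverse_limit_def)
  next
    assume "\<forall>p\<in>P. (\<phi> x p, \<phi> y p) \<in> le (D p)"
    then have 1: "(\<phi> x, \<phi> y) \<in> le ?L" "\<phi> x \<in> seps ?L" "\<phi> y \<in> seps ?L"
      using \<phi>L that by (auto simp: inverse_limit_def)
    have "homomorphism ?L S (inv_into ?X \<phi>)"
      using \<phi> by (simp add: isomorphism_def)
    with 1 have "(inv_into ?X \<phi> (\<phi> x), inv_into ?X \<phi> (\<phi> y)) \<in> le S"
      by (auto simp: homomorphism_def)
    then show "(x, y) \<in> le S"
      using bij that by (simp add: bij_betw_def inv_into_f_f)
  qed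
  have dirP: "directed_poset P R"
    and ssD: "\<And>p. p \<in> P \<Longrightarrow> separation_system (D p)"
    and finD: "\<And>p. p \<in> P \<Longrightarrow> finite (seps (D p))"
    and homf: "\<And>p q. (p, q) \<in> R \<Longrightarrow> homomorphism (D q) (D p) (f q p)"
    using sys by (auto simp: finite_inverse_system_def)
  have RP: "p \<in> P" "q \<in> P" if "(p, q) \<in> R" for p q
    using dirP that by (auto simp: directed_poset_def partial_order_on_def preorder_on_def)
  have reflD: "(a, a) \<in> le (D p)" if "p \<in> P" "a \<in> seps (D p)" for p a
    using ssD[OF that(1)] that(2)
    by (auto simp: separation_system_def partial_order_on_def preorder_on_def refl_on_def)
  have antisymD: "a = b" if "p \<in> P" "(a, b) \<in> le (D p)" "(b, a) \<in> le (D p)" for p a b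
    using ssD[OF that(1)] that(2,3)
    by (auto simp: separation_system_def partial_order_on_def antisym_def)
  have transD: "(a, c) \<in> le (D p)" if "p \<in> P" "(a, b) \<in> le (D p)" "(b, c) \<in> le (D p)" for p a b c
    using ssD[OF that(1)] that(2,3)
    unfolding separation_system_def partial_order_on_def preorder_on_def trans_def by blast
  have revD: "(flip (D p) b, flip (D p) a) \<in> le (D p)" if "p \<in> P" "(a, b) \<in> le (D p)" for p a b
    using ssD[OF that(1)] that(2) by (auto simp: separation_system_def)

  define K where "K p = {(x, y). x \<in> ?X \<and> y \<in> ?X \<and> (\<phi> x p, \<phi> y p) \<in> le (D p)}" for p
  define J where "J = K ` P"
  define Q where "Q = {(A, B). A \<in> J \<and> B \<in> J \<and> B \<subseteq> A}"
  have K_mono: "K q \<subseteq> K p" if "(p, q) \<in> R" for p q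
  proof -
    have "(\<phi> x p, \<phi> y p) \<in> le (D p)"
      if xy: "x \<in> ?X" "y \<in> ?X" "(\<phi> x q, \<phi> y q) \<in> le (D q)" for x y
    proof -
      have "(f q p (\<phi> x q), f q p (\<phi> y q)) \<in> le (D p)"
        using homf[OF \<open>(p, q) \<in> R\<close>] xy \<phi>D RP[OF \<open>(p, q) \<in> R\<close>] by (auto simp: homomorphism_def)
      then show ?thesis
        using \<phi>f xy \<open>(p, q) \<in> R\<close> by simp
    qed
    then show ?thesis by (auto simp: K_def)
  qed
  have J_X: "x \<in> ?X \<and> y \<in> ?X" if "A \<in> J" "(x, y) \<in> A" for A x y
    using that by (auto simp: J_def K_def)
  have J_refl: "(x, x) \<in> A" if "A \<in> J" "x \<in> ?X" for A x
    using that reflD \<phi>D by (auto simp: J_def K_def)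
  have J_trans: "(x, z) \<in> A" if "A \<in> J" "(x, y) \<in> A" "(y, z) \<in> A" for A x y z
    using that transD by (auto simp: J_def K_def)
  have J_flip: "(flip S y, flip S x) \<in> A" if "A \<in> J" "(x, y) \<in> A" for A x y
    using that revD flipX \<phi>flip by (auto simp: J_def K_def)
  have J_le: "(x, y) \<in> le S \<longleftrightarrow> (\<forall>A\<in>J. (x, y) \<in> A)" if "x \<in> ?X" "y \<in> ?X" for x y
    using \<phi>le that by (auto simp: J_def K_def)

  have "\<exists>e :: 'a \<Rightarrow> nat. finite (e ` ?X) \<and>
          (\<forall>x\<in>?X. \<forall>y\<in>?X. e x = e y \<longleftrightarrow> (x, y) \<in> A \<and> (y, x) \<in> A)" if "A \<in> J" for A
  proof -
    from that obtain p where p: "p \<in> P" "A = K p" by (auto simp: J_def)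
    obtain e0 :: "'e \<Rightarrow> nat" where e0: "inj_on e0 (seps (D p))"
      using finite_imp_inj_to_nat_seg[OF finD[OF p(1)]] by blast
    have "(\<lambda>x. e0 (\<phi> x p)) ` ?X \<subseteq> e0 ` seps (D p)"
      using \<phi>D p by auto
    then have fin: "finite ((\<lambda>x. e0 (\<phi> x p)) ` ?X)"
      using finD[OF p(1)] finite_subset by blast
    have "e0 (\<phi> x p) = e0 (\<phi> y p) \<longleftrightarrow> (x, y) \<in> A \<and> (y, x) \<in> A" if "x \<in> ?X" "y \<in> ?X" for x y
    proof -
      have "e0 (\<phi> x p) = e0 (\<phi> y p) \<longleftrightarrow> \<phi> x p = \<phi> y p"
        using inj_on_eq_iff[OF e0] \<phi>D that p by auto
      also have "\<dots> \<longleftrightarrow> (x, y) \<in> A \<and> (y, x) \<in> A"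
        using that p antisymD reflD \<phi>D by (auto simp: K_def)
      finally show ?thesis .
    qed
    with fin show ?thesis by blast
  qed
  then obtain h :: "('a \<times> 'a) set \<Rightarrow> 'a \<Rightarrow> nat"
    where h_fin: "\<And>A. A \<in> J \<Longrightarrow> finite (h A ` ?X)"
      and h_eq: "\<And>A x y. A \<in> J \<Longrightarrow> x \<in> ?X \<Longrightarrow> y \<in> ?X \<Longrightarrow>
                   h A x = h A y \<longleftrightarrow> (x, y) \<in> A \<and> (y, x) \<in> A"
    by metis
  define rep where "rep A n = (SOME x. x \<in> ?X \<and> h A x = n)" for A n
  have rep: "rep A (h A x) \<in> ?X" "h A (rep A (h A x)) = h A x" if "x \<in> ?X" for A x
    using someI[of "\<lambda>y. y \<in> ?X \<and> h A y = h A x" x] that by (auto simp: rep_def)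
  have rep_eq: "(x, rep A (h A x)) \<in> A" "(rep A (h A x), x) \<in> A" if "A \<in> J" "x \<in> ?X" for A x
    using h_eq[OF that(1) rep(1)[OF that(2)] that(2)] rep(2)[OF that(2)] by auto
  define E where "E A = \<lparr>seps = h A ` ?X, le = {(h A x, h A y) | x y. (x, y) \<in> A},
                          flip = (\<lambda>n. h A (flip S (rep A n)))\<rparr>" for A
  define g where "g B A n = h A (rep B n)" for B A n
  have E_le: "(h A x, h A y) \<in> le (E A) \<longleftrightarrow> (x, y) \<in> A" if "A \<in> J" "x \<in> ?X" "y \<in> ?X" for A x y
  proof
    assume "(h A x, h A y) \<in> le (E A)"
    then obtain x' y' where *: "h A x = h A x'" "h A y = h A y'" "(x', y') \<in> A"
      by (auto simp: E_def)
    then have "x' \<in> ?X" "y' \<in> ?X" using J_X that by blast+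
    then have "(x, x') \<in> A" "(y', y) \<in> A" using h_eq * that by auto
    then show "(x, y) \<in> A" using J_trans * that by blast
  qed (auto simp: E_def)
  have E_flip: "flip (E A) (h A x) = h A (flip S x)" if "A \<in> J" "x \<in> ?X" for A x
  proof -
    have "h A (flip S (rep A (h A x))) = h A (flip S x)"
      using h_eq[OF that(1) flipX[OF rep(1)[OF that(2)]] flipX[OF that(2)]]
        J_flip[OF that(1)] rep_eq[OF that] by blast
    then show ?thesis by (simp add: E_def)
  qed
  have E_seps: "seps (E A) = h A ` ?X" for A by (simp add: E_def)
  have E_leD: "\<exists>x y. m = h A x \<and> n = h A y \<and> x \<in> ?X \<and> y \<in> ?X \<and> (x, y) \<in> A"
    if "A \<in> J" "(m, n) \<in> le (E A)" for A m n
    using that J_X by (fastforce simp: E_def)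
  have g_h: "g B A (h B x) = h A x" if "(A, B) \<in> Q" "x \<in> ?X" for A B x
  proof -
    have "A \<in> J" "B \<in> J" "B \<subseteq> A" using that by (auto simp: Q_def)
    then show ?thesis
      using h_eq[OF _ rep(1)[OF that(2)] that(2)] rep_eq[OF _ that(2)]
      unfolding g_def by blast
  qed
  have ssE: "separation_system (E A)" if A: "A \<in> J" for A
    unfolding separation_system_def partial_order_on_def preorder_on_def
  proof (intro conjI ballI allI impI)
    show "le (E A) \<subseteq> seps (E A) \<times> seps (E A)"
      using E_leD[OF A] by (fastforce simp: E_seps)
    show "refl_on (seps (E A)) (le (E A))"
      using E_le[OF A] J_refl[OF A] by (auto simp: refl_on_def E_seps)
    show "trans (le (E A))"
    proof (rule transI)
      fix l m n assume lm: "(l, m) \<in> le (E A)" and mn: "(m, n) \<in> le (E A)"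
      obtain x y where 1: "l = h A x" "m = h A y" "x \<in> ?X" "y \<in> ?X" "(x, y) \<in> A"
        using E_leD[OF A lm] by blast
      obtain z where 2: "n = h A z" "z \<in> ?X"
        using E_leD[OF A mn] by blast
      have "(y, z) \<in> A" using mn 1 2 E_le[OF A] by blast
      then have "(x, z) \<in> A" using J_trans[OF A] 1 by blast
      then show "(l, n) \<in> le (E A)" using E_le[OF A] 1 2 by blast
    qed
    show "antisym (le (E A))"
    proof (rule antisymI)
      fix l m assume lm: "(l, m) \<in> le (E A)" and ml: "(m, l) \<in> le (E A)"
      obtain x y where 1: "l = h A x" "m = h A y" "x \<in> ?X" "y \<in> ?X" "(x, y) \<in> A"
        using E_leD[OF A lm] by blast
      then have "(y, x) \<in> A" using ml E_le[OF A] by blast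
      then show "l = m" using 1 h_eq[OF A] by blast
    qed
  next
    fix n assume "n \<in> seps (E A)"
    then obtain x where x: "n = h A x" "x \<in> ?X" by (auto simp: E_seps)
    show "flip (E A) n \<in> seps (E A)" using x E_flip[OF A] flipX by (auto simp: E_seps)
    show "flip (E A) (flip (E A) n) = n" using x E_flip[OF A] flipX flip2 by auto
  next
    fix m n assume mn: "(m, n) \<in> le (E A)"
    obtain x y where 1: "m = h A x" "n = h A y" "x \<in> ?X" "y \<in> ?X" "(x, y) \<in> A"
      using E_leD[OF A mn] by blast
    then have "(flip S y, flip S x) \<in> A" using J_flip[OF A] by blast
    then show "(flip (E A) n, flip (E A) m) \<in> le (E A)"
      using E_le[OF A] E_flip[OF A] flipX 1 by auto
  qed
  have dirJ: "directed_poset J Q"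
    unfolding directed_poset_def partial_order_on_def preorder_on_def
  proof (intro conjI ballI)
    show "J \<noteq> {}" using dirP by (auto simp: J_def directed_poset_def)
    fix A B assume "A \<in> J" "B \<in> J"
    then obtain p q where pq: "p \<in> P" "q \<in> P" "A = K p" "B = K q" by (auto simp: J_def)
    then obtain t where "t \<in> P" "(p, t) \<in> R" "(q, t) \<in> R"
      using dirP by (auto simp: directed_poset_def)
    then show "\<exists>C\<in>J. (A, C) \<in> Q \<and> (B, C) \<in> Q"
      using K_mono pq by (intro bexI[of _ "K t"]) (auto simp: Q_def J_def)
  qed (auto simp: Q_def refl_on_def trans_def antisym_def)
  have sysJ: "finite_inverse_system J Q E g"
    unfolding finite_inverse_system_def
  proof (intro conjI ballI allI impI)
    show "directed_poset J Q" by (fact dirJ)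
  next
    fix A assume "A \<in> J"
    then show "separation_system (E A)" "finite (seps (E A))"
      using ssE h_fin by (auto simp: E_seps)
  next
    fix A B assume AB: "(A, B) \<in> Q"
    then have J: "A \<in> J" "B \<in> J" "B \<subseteq> A" by (auto simp: Q_def)
    show "homomorphism (E B) (E A) (g B A)"
      using J E_le E_flip g_h[OF AB] flipX unfolding homomorphism_def
      by (auto simp: E_seps)
  next
    fix A n assume "A \<in> J" "n \<in> seps (E A)"
    then show "g A A n = n" using g_h[of A A] by (auto simp: E_seps Q_def)
  next
    fix A B C n assume "(A, B) \<in> Q" "(B, C) \<in> Q" "n \<in> seps (E C)"
    moreover from this have "(A, C) \<in> Q" by (auto simp: Q_def)
    ultimately show "g B A (g C B n) = g C A n"
      using g_h by (auto simp: E_seps)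
  qed

  define \<psi> where "\<psi> x = (\<lambda>A\<in>J. h A x)" for x
  let ?M = "inverse_limit J Q E g"
  let ?C = "compatible_families J Q E g"
  have \<psi>C: "\<psi> x \<in> ?C" if "x \<in> ?X" for x
    using that g_h by (auto simp: compatible_families_def \<psi>_def E_seps Q_def)
  have \<psi>le: "(\<psi> x, \<psi> y) \<in> le ?M \<longleftrightarrow> (x, y) \<in> le S" if "x \<in> ?X" "y \<in> ?X" for x y
  proof -
    have "(\<psi> x, \<psi> y) \<in> le ?M \<longleftrightarrow> (\<forall>A\<in>J. (h A x, h A y) \<in> le (E A))"
      using \<psi>C that by (simp add: inverse_limit_def \<psi>_def)
    then show ?thesis using E_le J_le that by simp
  qed
  have \<psi>flip: "\<psi> (flip S x) = flip ?M (\<psi> x)" if "x \<in> ?X" for x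
    using that E_flip by (auto simp: inverse_limit_def \<psi>_def fun_eq_iff)
  have inj: "inj_on \<psi> ?X"
  proof (rule inj_onI)
    fix x y assume xy: "x \<in> ?X" "y \<in> ?X" "\<psi> x = \<psi> y"
    have "(x, x) \<in> le S"
      using po xy(1) by (auto simp: partial_order_on_def preorder_on_def refl_on_def)
    then have "(x, y) \<in> le S" "(y, x) \<in> le S"
      using \<psi>le xy by metis+
    then show "x = y" using po by (auto simp: partial_order_on_def antisym_def)
  qed
  have surj: "\<exists>x\<in>?X. n = \<psi> x" if n: "n \<in> ?C" for n
  proof -
    have "\<forall>A\<in>J. \<exists>x\<in>?X. n A = h A x"
      using n by (force simp: compatible_families_def E_seps PiE_def Pi_def)
    then obtain y where y: "\<And>A. A \<in> J \<Longrightarrow> y A \<in> ?X" "\<And>A. A \<in> J \<Longrightarrow> n A = h A (y A)"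
      by metis
    have KJ: "K p \<in> J" if "p \<in> P" for p using that by (auto simp: J_def)
    define z where "z = (\<lambda>p\<in>P. \<phi> (y (K p)) p)"
    have "f q p (z q) = z p" if pq: "(p, q) \<in> R" for p q
    proof -
      have P: "p \<in> P" "q \<in> P" using RP[OF pq] .
      have Q: "(K p, K q) \<in> Q" using K_mono[OF pq] P by (auto simp: Q_def J_def)
      have "h (K p) (y (K q)) = g (K q) (K p) (n (K q))"
        using g_h[OF Q] y KJ P by simp
      also have "\<dots> = n (K p)"
        using n Q by (auto simp: compatible_families_def)
      finally have "h (K p) (y (K q)) = h (K p) (y (K p))"
        using y KJ P by simp
      then have "(y (K q), y (K p)) \<in> K p" "(y (K p), y (K q)) \<in> K p"
        using h_eq[OF KJ[OF P(1)]] y(1) KJ P by auto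
      then have "\<phi> (y (K q)) p = \<phi> (y (K p)) p"
        using antisymD[OF P(1)] by (auto simp: K_def)
      moreover have "f q p (\<phi> (y (K q)) q) = \<phi> (y (K q)) p"
        using \<phi>f[OF _ pq] y(1) KJ P by auto
      ultimately show ?thesis using P by (simp add: z_def)
    qed
    then have "z \<in> compatible_families P R D f"
      using \<phi>D y(1) KJ by (auto simp: compatible_families_def z_def)
    then obtain x where x: "x \<in> ?X" "\<phi> x = z"
      using bij unfolding bij_betw_def by (metis imageE)
    have "n A = h A x" if A: "A \<in> J" for A
    proof -
      from A obtain p where p: "p \<in> P" "A = K p" by (auto simp: J_def)
      have "\<phi> x p = \<phi> (y A) p" using x p by (simp add: z_def)
      then have "(x, y A) \<in> A" "(y A, x) \<in> A"
        using x y(1)[OF A] p reflD \<phi>D by (auto simp: K_def)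
      then show ?thesis using h_eq[OF A] x y A by metis
    qed
    moreover have "n \<in> extensional J"
      using n by (auto simp: compatible_families_def PiE_def)
    ultimately have "n = \<psi> x"
      by (auto simp: \<psi>_def fun_eq_iff extensional_def)
    with x show ?thesis by blast
  qed
  have M: "seps ?M = ?C" by (simp add: inverse_limit_def)
  have bij\<psi>: "bij_betw \<psi> ?X (seps ?M)"
    using inj surj \<psi>C by (auto simp: bij_betw_def M)
  have inv\<psi>: "inv_into ?X \<psi> (\<psi> x) = x" if "x \<in> ?X" for x
    using inj that by simp
  have hom1: "homomorphism S ?M \<psi>"
    using \<psi>C \<psi>flip \<psi>le by (auto simp: homomorphism_def M)
  have hom2: "homomorphism ?M S (inv_into ?X \<psi>)"
    unfolding homomorphism_def
  proof (intro conjI ballI impI funcsetI)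
    fix n assume "n \<in> seps ?M"
    then obtain x where x: "x \<in> ?X" "n = \<psi> x" using surj M by auto
    then show "inv_into ?X \<psi> n \<in> ?X" using inv\<psi> by simp
    show "inv_into ?X \<psi> (flip ?M n) = flip S (inv_into ?X \<psi> n)"
      using x inv\<psi> flipX by (simp flip: \<psi>flip)
  next
    fix m n assume "m \<in> seps ?M" "n \<in> seps ?M" "(m, n) \<in> le ?M"
    moreover from this obtain x y where "x \<in> ?X" "m = \<psi> x" "y \<in> ?X" "n = \<psi> y"
      using surj M by metis
    ultimately show "(inv_into ?X \<psi> m, inv_into ?X \<psi> n) \<in> le S"
      using inv\<psi> \<psi>le by simp
  qed
  have "isomorphic S ?M"
    using bij\<psi> hom1 hom2 by (auto simp: isomorphic_def isomorphism_def)
  with sysJ show ?thesis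
    unfolding profinite_def by blast
qed

end

theory Submission
  imports Defs "HOL-Analysis.Product_Topology"
begin

text \<open>
  If \<open>\<tau>\<close> is profinite, then the projections of a chain are finite chains, and their maxima form a
  compatible family, which is the supremum. For \<open>r < s\<close>, choose a projection that separates them:
  the supremum of the part of the interval \<open>[r, s]\<close> that projects like \<open>r\<close> and the infimum of the
  rest form a covering pair, and a covering pair determines a splitting star.

  Conversely, every splitting star \<open>\<sigma>\<close> gives a finite quotient of \<open>\<tau>\<close> that only records beyond which
  element of \<open>\<sigma>\<close> a separation lies, and in which direction it points. These quotients jointly
  reflect the order. A choice of values \<open>d\<close> that is finitely realised amounts to upper bounds \<open>A\<close> and
  lower bounds \<open>B\<close> for the element to be found. If both are non-empty, then the supremum of a chain
  in \<open>B\<close> meets the infimum of a chain in \<open>A\<close>, since a splitting star in between would contribute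
  another bound. If \<open>B\<close> is empty, one of the finitely many minimal elements of \<open>\<tau>\<close> will do.
\<close>

section \<open>Finite quotients and inverse limits\<close>

text \<open>Serves for images of chains in the finite \<open>D p\<close>: a greatest image exists
  there even if the chain itself has no greatest element. The comparability hypothesis with
  \<open>x = y\<close> supplies reflexivity.\<close>

lemma finite_chain_greatest:
  assumes "finite A" "A \<noteq> {}"
    and "\<And>x y. x \<in> A \<Longrightarrow> y \<in> A \<Longrightarrow> (x, y) \<in> r \<or> (y, x) \<in> r" and "trans r"
  shows "\<exists>m\<in>A. \<forall>a\<in>A. (a, m) \<in> r"
  using assms(1-3)
proof (induction rule: finite_ne_induct)
  case (singleton x)
  then show ?case by auto
next
  case (insert x F)
  then obtain m where m: "m \<in> F" "\<And>a. a \<in> F \<Longrightarrow> (a, m) \<in> r" by blast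
  have "(x, x) \<in> r" using insert.prems by blast
  show ?case
  proof (cases "(x, m) \<in> r")
    case True
    then show ?thesis using m by blast
  next
    case False
    then have "(m, x) \<in> r" using insert.prems m(1) by blast
    then show ?thesis using m \<open>(x, x) \<in> r\<close> transD[OF \<open>trans r\<close>] by blast
  qed
qed

text \<open>The assumption \<open>refl\<close> makes the map from \<open>S\<close> to the inverse limit of the images of \<open>S\<close>
  under finitely many \<open>h i\<close> an embedding, and \<open>cpt\<close> (compactness) makes it surjective.\<close>

lemma profinite_if_separating:
  fixes S :: "'a sepsys" and D :: "'i \<Rightarrow> 'e sepsys"
  assumes S: "separation_system S"
    and D: "\<And>i. i \<in> I \<Longrightarrow> separation_system (D i)" "\<And>i. i \<in> I \<Longrightarrow> finite (seps (D i))"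
    and hom: "\<And>i. i \<in> I \<Longrightarrow> homomorphism S (D i) (h i)"
    and refl: "\<And>x y. x \<in> seps S \<Longrightarrow> y \<in> seps S \<Longrightarrow> \<forall>i\<in>I. (h i x, h i y) \<in> le (D i) \<Longrightarrow> (x, y) \<in> le S"
    and cpt: "\<And>d. (\<And>J. J \<subseteq> I \<Longrightarrow> finite J \<Longrightarrow> \<exists>x\<in>seps S. \<forall>i\<in>J. h i x = d i) \<Longrightarrow>
                  \<exists>x\<in>seps S. \<forall>i\<in>I. h i x = d i"
  shows "profinite S"
proof -
  let ?X = "seps S"
  define k where "k J x = (\<lambda>i\<in>J. h i x)" for J x
  \<comment> \<open>The image of \<open>S\<close> in the finite product of the \<open>D i\<close>,
    not the whole product: every coordinate of a compatible family is then realised by an element of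
    \<open>S\<close>, which is what \<open>cpt\<close> asks for.\<close>
  define E where "E J = \<lparr>seps = k J ` ?X,
    le = {(u, v). u \<in> k J ` ?X \<and> v \<in> k J ` ?X \<and> (\<forall>i\<in>J. (u i, v i) \<in> le (D i))},
    flip = (\<lambda>u. \<lambda>i\<in>J. flip (D i) (u i))\<rparr>" for J
  define P where "P = {J. J \<subseteq> I \<and> finite J}"
  define R where "R = {(J, K). J \<in> P \<and> K \<in> P \<and> J \<subseteq> K}"
  define f where "f K J u = restrict u J" for K J :: "'i set" and u :: "'i \<Rightarrow> 'e"
  let ?L = "inverse_limit P R E f"
  let ?C = "compatible_families P R E f"
  have po: "antisym (le S)" and reflS: "\<And>x. x \<in> ?X \<Longrightarrow> (x, x) \<in> le S"
    and flipX: "\<And>x. x \<in> ?X \<Longrightarrow> flip S x \<in> ?X" and flip2: "\<And>x. x \<in> ?X \<Longrightarrow> flip S (flip S x) = x"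
    using S by (auto simp: separation_system_def partial_order_on_def preorder_on_def refl_on_def)
  have hD: "h i x \<in> seps (D i)" if "i \<in> I" "x \<in> ?X" for i x
    using hom[OF that(1)] that(2-) by (auto simp: homomorphism_def)
  have hflip: "h i (flip S x) = flip (D i) (h i x)" if "i \<in> I" "x \<in> ?X" for i x
    using hom[OF that(1)] that(2-) by (auto simp: homomorphism_def)
  have hle: "(h i x, h i y) \<in> le (D i)" if "i \<in> I" "x \<in> ?X" "y \<in> ?X" "(x, y) \<in> le S" for i x y
    using hom[OF that(1)] that(2-) by (auto simp: homomorphism_def)
  have D_refl: "(a, a) \<in> le (D i)" if "i \<in> I" "a \<in> seps (D i)" for i a
    using D(1)[OF that(1)] that(2)
    by (auto simp: separation_system_def partial_order_on_def preorder_on_def refl_on_def)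
  have D_antisym: "a = b" if "i \<in> I" "(a, b) \<in> le (D i)" "(b, a) \<in> le (D i)" for i a b
    using D(1)[OF that(1)] that(2,3)
    by (auto simp: separation_system_def partial_order_on_def antisym_def)
  have D_trans: "(a, c) \<in> le (D i)" if "i \<in> I" "(a, b) \<in> le (D i)" "(b, c) \<in> le (D i)" for i a b c
    using D(1)[OF that(1)] that(2,3)
    unfolding separation_system_def partial_order_on_def preorder_on_def trans_def by blast
  have D_rev: "(flip (D i) b, flip (D i) a) \<in> le (D i)" if "i \<in> I" "(a, b) \<in> le (D i)" for i a b
    using D(1)[OF that(1)] that(2) by (auto simp: separation_system_def)
  have PI: "i \<in> I" if "J \<in> P" "i \<in> J" for J i using that by (auto simp: P_def)
  have k_app: "k J x i = h i x" if "i \<in> J" for J x i using that by (simp add: k_def)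
  have E_seps: "seps (E J) = k J ` ?X" for J by (simp add: E_def)
  have E_le: "(k J x, k J y) \<in> le (E J) \<longleftrightarrow> (\<forall>i\<in>J. (h i x, h i y) \<in> le (D i))"
    if "x \<in> ?X" "y \<in> ?X" for J x y
    using that by (simp add: E_def k_app)
  have E_leD: "\<exists>x y. u = k J x \<and> v = k J y \<and> x \<in> ?X \<and> y \<in> ?X \<and> (\<forall>i\<in>J. (h i x, h i y) \<in> le (D i))"
    if "(u, v) \<in> le (E J)" for J u v
  proof -
    from that obtain x y where "u = k J x" "v = k J y" "x \<in> ?X" "y \<in> ?X" by (auto simp: E_def)
    then show ?thesis using that E_le by blast
  qed
  have E_flip: "flip (E J) (k J x) = k J (flip S x)" if "J \<in> P" "x \<in> ?X" for J x
    using that hflip PI by (auto simp: E_def k_def)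
  have f_k: "f K J (k K x) = k J x" if "J \<subseteq> K" for J K x
    using that by (auto simp: f_def k_def fun_eq_iff)
  have ssE: "separation_system (E J)" if J: "J \<in> P" for J
    unfolding separation_system_def partial_order_on_def preorder_on_def
  proof (intro conjI ballI allI impI)
    show "le (E J) \<subseteq> seps (E J) \<times> seps (E J)" by (auto simp: E_def)
    show "refl_on (seps (E J)) (le (E J))"
      using E_le D_refl hD PI[OF J] by (auto simp: refl_on_def E_seps)
    show "trans (le (E J))"
    proof (rule transI)
      fix u v w assume "(u, v) \<in> le (E J)" "(v, w) \<in> le (E J)"
      then show "(u, w) \<in> le (E J)"
        unfolding E_def using D_trans PI[OF J] by simp blast
    qed
    show "antisym (le (E J))"
    proof (rule antisymI)
      fix u v assume uv: "(u, v) \<in> le (E J)" "(v, u) \<in> le (E J)"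
      then have "\<forall>i\<in>J. u i = v i"
        using D_antisym PI[OF J] unfolding E_def by simp blast
      moreover have "u \<in> extensional J" "v \<in> extensional J"
        using uv(1) by (auto simp: E_def k_def)
      ultimately show "u = v" by (auto simp: fun_eq_iff extensional_def)
    qed
  next
    fix u assume "u \<in> seps (E J)"
    then obtain x where x: "u = k J x" "x \<in> ?X" by (auto simp: E_seps)
    show "flip (E J) u \<in> seps (E J)" using x E_flip[OF J] flipX by (auto simp: E_seps)
    show "flip (E J) (flip (E J) u) = u" using x E_flip[OF J] flipX flip2 by auto
  next
    fix u v assume "(u, v) \<in> le (E J)"
    then obtain x y where xy: "u = k J x" "v = k J y" "x \<in> ?X" "y \<in> ?X"
      "\<forall>i\<in>J. (h i x, h i y) \<in> le (D i)"
      using E_leD by blast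
    then have "\<forall>i\<in>J. (h i (flip S y), h i (flip S x)) \<in> le (D i)"
      using D_rev hflip PI[OF J] by simp
    then show "(flip (E J) v, flip (E J) u) \<in> le (E J)"
      using xy E_flip[OF J] E_le flipX by simp
  qed
  have fin: "finite (seps (E J))" if J: "J \<in> P" for J
  proof -
    have "seps (E J) \<subseteq> (\<Pi>\<^sub>E i\<in>J. seps (D i))"
      using hD PI[OF J] by (auto simp: E_seps k_def)
    moreover have "finite \<dots>"
      using J PI[OF J] D(2) by (intro finite_PiE) (auto simp: P_def)
    ultimately show ?thesis by (rule finite_subset)
  qed
  have sys: "finite_inverse_system P R E f"
    unfolding finite_inverse_system_def
  proof (intro conjI ballI allI impI)
    show "directed_poset P R"
      unfolding directed_poset_def partial_order_on_def preorder_on_def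
    proof (intro conjI ballI)
      show "P \<noteq> {}" by (auto simp: P_def)
      fix J K assume "J \<in> P" "K \<in> P"
      then show "\<exists>T\<in>P. (J, T) \<in> R \<and> (K, T) \<in> R"
        by (intro bexI[of _ "J \<union> K"]) (auto simp: R_def P_def)
    qed (auto simp: R_def refl_on_def trans_def antisym_def)
  next
    fix J assume "J \<in> P"
    then show "separation_system (E J)" "finite (seps (E J))" using ssE fin by auto
  next
    fix J K assume "(J, K) \<in> R"
    then have JK: "J \<in> P" "K \<in> P" "J \<subseteq> K" by (auto simp: R_def)
    show "homomorphism (E K) (E J) (f K J)"
      unfolding homomorphism_def
      using JK(3) E_le E_flip[OF JK(1)] E_flip[OF JK(2)] f_k[OF JK(3)] flipX
      by (auto simp: E_seps)
  next
    fix J u assume "J \<in> P" "u \<in> seps (E J)"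
    then show "f J J u = u" using f_k by (auto simp: E_seps)
  next
    fix J K T u assume "(J, K) \<in> R" "(K, T) \<in> R" "u \<in> seps (E T)"
    moreover from this have "J \<subseteq> K" "K \<subseteq> T" "J \<subseteq> T" by (auto simp: R_def)
    ultimately show "f K J (f T K u) = f T J u" using f_k by (auto simp: E_seps)
  qed
  define \<psi> where "\<psi> x = (\<lambda>J\<in>P. k J x)" for x
  have \<psi>C: "\<psi> x \<in> ?C" if "x \<in> ?X" for x
    using that f_k by (auto simp: compatible_families_def \<psi>_def E_seps R_def)
  have \<psi>le: "(\<psi> x, \<psi> y) \<in> le ?L \<longleftrightarrow> (x, y) \<in> le S" if xy: "x \<in> ?X" "y \<in> ?X" for x y
  proof -
    have "(\<psi> x, \<psi> y) \<in> le ?L \<longleftrightarrow> (\<forall>J\<in>P. \<forall>i\<in>J. (h i x, h i y) \<in> le (D i))"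
      using \<psi>C xy E_le by (simp add: inverse_limit_def \<psi>_def)
    also have "\<dots> \<longleftrightarrow> (\<forall>i\<in>I. (h i x, h i y) \<in> le (D i))"
    proof safe
      fix i assume *: "\<forall>J\<in>P. \<forall>i\<in>J. (h i x, h i y) \<in> le (D i)" "i \<in> I"
      then have "{i} \<in> P" by (simp add: P_def)
      with * show "(h i x, h i y) \<in> le (D i)" by blast
    qed (use PI in blast)
    also have "\<dots> \<longleftrightarrow> (x, y) \<in> le S"
      using refl hle xy by blast
    finally show ?thesis .
  qed
  have \<psi>flip: "\<psi> (flip S x) = flip ?L (\<psi> x)" if "x \<in> ?X" for x
    using that E_flip by (auto simp: inverse_limit_def \<psi>_def fun_eq_iff)
  have inj: "inj_on \<psi> ?X"
  proof (rule inj_onI)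
    fix x y assume xy: "x \<in> ?X" "y \<in> ?X" "\<psi> x = \<psi> y"
    then have "(x, y) \<in> le S" "(y, x) \<in> le S"
      using \<psi>le reflS by metis+
    then show "x = y" using po by (auto dest: antisymD)
  qed
  have surj: "\<exists>x\<in>?X. u = \<psi> x" if u: "u \<in> ?C" for u
  proof -
    have uE: "\<exists>x\<in>?X. u J = k J x" if "J \<in> P" for J
      using u that by (force simp: compatible_families_def E_seps PiE_def Pi_def)
    have uR: "restrict (u K) J = u J" if "(J, K) \<in> R" for J K
      using u that by (auto simp: compatible_families_def f_def)
    \<comment> \<open>A compatible family is determined by its values at singletons, since
      restricting \<open>u J\<close> to \<open>{i}\<close> gives \<open>u {i}\<close>.\<close>
    define d where "d i = u {i} i" for i
    have ud: "u J i = d i" if "J \<in> P" "i \<in> J" for J i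
    proof -
      have "({i}, J) \<in> R" using that by (auto simp: R_def P_def)
      from uR[OF this] show ?thesis unfolding d_def by (metis restrict_apply' singletonI)
    qed
    have "\<exists>x\<in>?X. \<forall>i\<in>I. h i x = d i"
    proof (rule cpt)
      fix J assume "J \<subseteq> I" "finite J"
      then have J: "J \<in> P" by (simp add: P_def)
      with uE obtain x where "x \<in> ?X" "u J = k J x" by blast
      then show "\<exists>x\<in>?X. \<forall>i\<in>J. h i x = d i" using ud[OF J] k_app by metis
    qed
    then obtain x where x: "x \<in> ?X" "\<forall>i\<in>I. h i x = d i" by blast
    have "u J = k J x" if J: "J \<in> P" for J
    proof -
      obtain y where y: "u J = k J y" using uE[OF J] by blast
      have "h i y = h i x" if "i \<in> J" for i
        using x(2) ud[OF J that] y k_app[OF that] PI[OF J that] by metis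
      then show ?thesis unfolding y by (auto simp: k_def)
    qed
    moreover have "u \<in> extensional P"
      using u by (auto simp: compatible_families_def PiE_def)
    ultimately have "u = \<psi> x"
      by (auto simp: \<psi>_def fun_eq_iff extensional_def)
    with x show ?thesis by blast
  qed
  have L: "seps ?L = ?C" by (simp add: inverse_limit_def)
  have bij: "bij_betw \<psi> ?X (seps ?L)"
    using inj surj \<psi>C by (auto simp: bij_betw_def L)
  have inv\<psi>: "inv_into ?X \<psi> (\<psi> x) = x" if "x \<in> ?X" for x
    using inj that by simp
  have hom1: "homomorphism S ?L \<psi>"
    using \<psi>C \<psi>flip \<psi>le by (auto simp: homomorphism_def L)
  have hom2: "homomorphism ?L S (inv_into ?X \<psi>)"
    unfolding homomorphism_def
  proof (intro conjI ballI impI funcsetI)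
    fix u assume "u \<in> seps ?L"
    then obtain x where x: "x \<in> ?X" "u = \<psi> x" using surj L by auto
    then show "inv_into ?X \<psi> u \<in> ?X" using inv\<psi> by simp
    show "inv_into ?X \<psi> (flip ?L u) = flip S (inv_into ?X \<psi> u)"
      using x inv\<psi> flipX by (simp flip: \<psi>flip)
  next
    fix u v assume "u \<in> seps ?L" "v \<in> seps ?L" "(u, v) \<in> le ?L"
    moreover from this obtain x y where "x \<in> ?X" "u = \<psi> x" "y \<in> ?X" "v = \<psi> y"
      using surj L by metis
    ultimately show "(inv_into ?X \<psi> u, inv_into ?X \<psi> v) \<in> le S"
      using inv\<psi> \<psi>le by simp
  qed
  have "isomorphic S ?L"
    using bij hom1 hom2 by (auto simp: isomorphic_def isomorphism_def)
  then show ?thesis using profiniteI[OF S sys] by blast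
qed

text \<open>\<open>(True, s)\<close> stands for the separations \<open>x \<le> s\<close>, which point towards the star \<open>\<sigma>\<close> from beyond \<open>s\<close>,
  and \<open>(False, s)\<close> for their inverses.\<close>

definition star_sys :: "'b set \<Rightarrow> (bool \<times> 'b) sepsys" where
  "star_sys \<sigma> = \<lparr>seps = UNIV \<times> \<sigma>,
     le = {((b, s), (c, t)). s \<in> \<sigma> \<and> t \<in> \<sigma> \<and> (b = c \<and> s = t \<or> b \<and> \<not> c)},
     flip = (\<lambda>(b, s). (\<not> b, s))\<rparr>"

lemma separation_system_star_sys: "separation_system (star_sys \<sigma>)"
  by (auto simp: star_sys_def separation_system_def partial_order_on_def preorder_on_def
      refl_on_def trans_def antisym_def)

section \<open>Regular tree sets\<close>

locale regular_tree_set =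
  fixes S :: "'a sepsys"
  assumes tree_set: "tree_set S" and regular: "regular S"
begin

abbreviation leq (infix "\<preceq>" 50) where "x \<preceq> y \<equiv> (x, y) \<in> le S"
abbreviation bar where "bar \<equiv> flip S"

lemma sep: "separation_system S" and po: "partial_order_on (seps S) (le S)"
  using tree_set by (auto simp: tree_set_def separation_system_def)

lemma le_in: "x \<preceq> y \<Longrightarrow> x \<in> seps S" "x \<preceq> y \<Longrightarrow> y \<in> seps S"
  using po by (auto simp: partial_order_on_def preorder_on_def)

lemma le_refl: "x \<in> seps S \<Longrightarrow> x \<preceq> x"
  using po by (auto simp: partial_order_on_def preorder_on_def refl_on_def)

lemma le_trans [trans]: "x \<preceq> y \<Longrightarrow> y \<preceq> z \<Longrightarrow> x \<preceq> z"
  using po unfolding partial_order_on_def preorder_on_def trans_def by blast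

lemma le_antisym: "x \<preceq> y \<Longrightarrow> y \<preceq> x \<Longrightarrow> x = y"
  using po by (auto simp: partial_order_on_def antisym_def)

lemma bar_in [simp]: "x \<in> seps S \<Longrightarrow> bar x \<in> seps S"
  and bar_bar [simp]: "x \<in> seps S \<Longrightarrow> bar (bar x) = x"
  and bar_le: "x \<preceq> y \<Longrightarrow> bar y \<preceq> bar x"
  using sep by (auto simp: separation_system_def)

lemma bar_le_left: "x \<in> seps S \<Longrightarrow> bar x \<preceq> y \<Longrightarrow> bar y \<preceq> x"
  and bar_le_right: "y \<in> seps S \<Longrightarrow> x \<preceq> bar y \<Longrightarrow> y \<preceq> bar x"
  using bar_le bar_bar by metis+

lemma bar_le_iff: "x \<in> seps S \<Longrightarrow> y \<in> seps S \<Longrightarrow> bar x \<preceq> bar y \<longleftrightarrow> y \<preceq> x"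
  using bar_le bar_bar by metis

lemma not_le_bar: "\<not> x \<preceq> bar x"
  using regular le_in by (auto simp: regular_def small_def)

lemma not_bar_le: "\<not> bar x \<preceq> x"
  using not_le_bar[of "bar x"] le_in(2) by fastforce

text \<open>Otherwise \<open>x\<close> would be trivial or, if it is itself an orientation of
  \<open>y\<close>, small.\<close>

lemma not_le_both: "\<not> (x \<preceq> y \<and> x \<preceq> bar y)"
proof
  assume a: "x \<preceq> y \<and> x \<preceq> bar y"
  then have "x \<in> seps S" "y \<in> seps S" using le_in by auto
  moreover have "x \<noteq> y" "x \<noteq> bar y" using a not_le_bar not_bar_le by auto
  ultimately show False
    using tree_set a by (auto simp: tree_set_def trivial_def sless_def)
qed

lemma not_both_le: "\<not> (x \<preceq> y \<and> bar x \<preceq> y)"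
  using not_le_both bar_le bar_bar le_in by metis

lemma nested_cases:
  assumes "x \<in> seps S" "y \<in> seps S"
  obtains "x \<preceq> y" | "y \<preceq> x" | "x \<preceq> bar y" | "bar x \<preceq> y"
proof -
  have "x \<preceq> y \<or> bar x \<preceq> y \<or> x \<preceq> bar y \<or> bar x \<preceq> bar y"
    using tree_set assms by (auto simp: tree_set_def nested_def unoriented_def)
  then show thesis using that bar_le_iff assms by blast
qed

text \<open>The only other way for \<open>x\<close> and \<open>y\<close> to have the same unoriented
  separation is \<open>y = bar x\<close>, and then \<open>x\<close> would be small.\<close>

lemma lneqq_iff: "lneqq S x y \<longleftrightarrow> x \<preceq> y \<and> x \<noteq> y"
  using not_le_bar not_bar_le bar_bar le_in
  by (auto simp: lneqq_def unoriented_def doubleton_eq_iff)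

text \<open>Nestedness leaves two other cases: \<open>w \<preceq> bar w'\<close> would put
  \<open>r\<close> below both orientations of \<open>w'\<close>, and
  \<open>bar w \<preceq> w'\<close> would put both orientations of \<open>w\<close> below
  \<open>s\<close>.\<close>

lemma interval_comparable:
  assumes "r \<preceq> w" "w \<preceq> s" "r \<preceq> w'" "w' \<preceq> s"
  shows "w \<preceq> w' \<or> w' \<preceq> w"
proof -
  have "\<not> w \<preceq> bar w'" using assms not_le_both le_trans by blast
  moreover have "\<not> bar w \<preceq> w'" using assms not_both_le le_trans by blast
  ultimately show ?thesis using nested_cases le_in assms by metis
qed

section \<open>Maximal elements and suprema of chains\<close>

lemma ex_maximal_above:
  assumes "A \<subseteq> seps S" "z \<in> A"
    and ub: "\<And>C. C \<in> Chains (le S) \<Longrightarrow> z \<in> C \<Longrightarrow> C \<subseteq> A \<Longrightarrow> \<exists>u\<in>A. \<forall>c\<in>C. c \<preceq> u"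
  shows "\<exists>m\<in>A. z \<preceq> m \<and> (\<forall>a\<in>A. m \<preceq> a \<longrightarrow> a = m)"
proof -
  let ?A = "{w \<in> A. z \<preceq> w}"
  let ?r = "le S \<inter> ?A \<times> ?A"
  have z: "z \<in> ?A" using assms le_refl by auto
  have F: "Field ?r = ?A"
    unfolding Field_def using assms(1) le_refl by blast
  have "Partial_order ?r"
    unfolding F partial_order_on_def preorder_on_def refl_on_def trans_def antisym_def
    using assms(1) le_refl le_trans le_antisym by blast
  moreover have "\<exists>u\<in>Field ?r. \<forall>a\<in>C. (a, u) \<in> ?r" if C: "C \<in> Chains ?r" for C
  proof -
    have CA: "C \<subseteq> ?A" and "C \<in> Chains (le S)" using C by (auto simp: Chains_def)
    \<comment> \<open>Adding \<open>z\<close> makes the chain non-empty, as chain-completeness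
      requires, and forces its upper bound into the part of \<open>A\<close> above
      \<open>z\<close>.\<close>
    then have "insert z C \<in> Chains (le S)"
      using z le_refl assms(1) by (fastforce simp: Chains_def)
    then obtain u where u: "u \<in> A" "\<forall>c\<in>insert z C. c \<preceq> u"
      using ub[of "insert z C"] CA assms(2) by auto
    then show ?thesis unfolding F using CA by (intro bexI[of _ u]) auto
  qed
  ultimately have "\<exists>m\<in>Field ?r. \<forall>a\<in>Field ?r. (m, a) \<in> ?r \<longrightarrow> a = m"
    by (rule Zorns_po_lemma)
  then obtain m where m: "m \<in> ?A" "\<forall>a\<in>?A. (m, a) \<in> ?r \<longrightarrow> a = m"
    unfolding F by blast
  have "a = m" if "a \<in> A" "m \<preceq> a" for a
  proof -
    have "a \<in> ?A" using le_trans[of z m a] that m(1) by simp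
    then show ?thesis using m that by blast
  qed
  then show ?thesis using m(1) by blast
qed

lemma chain_completeD:
  assumes "chain_complete S" "C \<subseteq> seps S" "C \<in> Chains (le S)" "C \<noteq> {}"
  obtains u where "u \<in> seps S" "\<And>c. c \<in> C \<Longrightarrow> c \<preceq> u"
    "\<And>v. v \<in> seps S \<Longrightarrow> (\<And>c. c \<in> C \<Longrightarrow> c \<preceq> v) \<Longrightarrow> u \<preceq> v"
proof -
  obtain u where "is_supremum S C u" using assms by (auto simp: chain_complete_def)
  then show thesis using that unfolding is_supremum_def by blast
qed

text \<open>The involution turns the supremum of the inverted chain into an infimum.\<close>

lemma chain_complete_inf:
  assumes "chain_complete S" "C \<subseteq> seps S" "C \<in> Chains (le S)" "C \<noteq> {}"
  obtains u where "u \<in> seps S" "\<And>c. c \<in> C \<Longrightarrow> u \<preceq> c"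
    "\<And>v. v \<in> seps S \<Longrightarrow> (\<And>c. c \<in> C \<Longrightarrow> v \<preceq> c) \<Longrightarrow> v \<preceq> u"
proof -
  have "bar ` C \<subseteq> seps S" using assms(2) by auto
  moreover have "bar ` C \<in> Chains (le S)"
    using assms(3) bar_le unfolding Chains_def by fast
  ultimately obtain u where u: "u \<in> seps S" "\<And>c. c \<in> bar ` C \<Longrightarrow> c \<preceq> u"
    "\<And>v. v \<in> seps S \<Longrightarrow> (\<And>c. c \<in> bar ` C \<Longrightarrow> c \<preceq> v) \<Longrightarrow> u \<preceq> v"
    using chain_completeD[OF assms(1)] assms(4) by (metis image_is_empty)
  show thesis
  proof
    show "bar u \<in> seps S" using u by simp
    show "bar u \<preceq> c" if "c \<in> C" for c
      using u(2) that assms(2) bar_le_left by blast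
    fix v assume v: "v \<in> seps S" "\<And>c. c \<in> C \<Longrightarrow> v \<preceq> c"
    have "u \<preceq> bar v"
      by (rule u(3)) (use v bar_le bar_in in blast)+
    then show "v \<preceq> bar u" using bar_le_right v(1) by blast
  qed
qed

lemma ex_maximal:
  assumes "chain_complete S" "z \<in> seps S"
  obtains m where "z \<preceq> m" "\<And>a. m \<preceq> a \<Longrightarrow> a = m"
proof -
  have "\<exists>m\<in>seps S. z \<preceq> m \<and> (\<forall>a\<in>seps S. m \<preceq> a \<longrightarrow> a = m)"
  proof (rule ex_maximal_above)
    fix C assume "C \<in> Chains (le S)" "z \<in> C" "C \<subseteq> seps S"
    then show "\<exists>u\<in>seps S. \<forall>c\<in>C. c \<preceq> u"
      using chain_completeD[OF assms(1), of C] by (metis empty_iff)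
  qed (use assms in auto)
  then show thesis using that le_in by blast
qed

section \<open>Splitting stars and their orientations\<close>

text \<open>Distinct maximal elements \<open>r\<close> and \<open>s\<close> are incomparable, and
  they are not inverse to each other because an orientation contains both. Consistency therefore
  excludes \<open>bar r \<preceq> s\<close>, and nestedness leaves only
  \<open>r \<preceq> bar s\<close>.\<close>

lemma splitting_star_star:
  assumes "splitting_star S \<sigma>"
  shows "star S \<sigma>"
proof -
  obtain Or where O: "orientation S Or" "consistent S Or" "\<sigma> = maximal_elements S Or"
    using assms by (auto simp: splitting_star_def)
  have OS: "Or \<subseteq> seps S" using O(1) by (simp add: orientation_def)
  have "r \<preceq> bar s" if rs: "r \<in> \<sigma>" "s \<in> \<sigma>" "r \<noteq> s" for r s
  proof -
    have S: "r \<in> seps S" "s \<in> seps S" "r \<in> Or" "s \<in> Or"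
      using rs O OS by (auto simp: maximal_elements_def)
    have n: "\<not> r \<preceq> s" "\<not> s \<preceq> r"
      using rs O(3) S by (auto simp: maximal_elements_def sless_def)
    have "r \<noteq> bar s"
      using O(1) S rs(3) by (auto simp: orientation_def unoriented_def)
    then have "unoriented S r \<noteq> unoriented S s"
      using rs(3) by (auto simp: unoriented_def doubleton_eq_iff)
    then have "\<not> bar r \<preceq> s"
      using O(2) S by (auto simp: consistent_def)
    then show ?thesis using n S nested_cases by metis
  qed
  moreover have "\<sigma> \<subseteq> seps S" using O OS by (auto simp: maximal_elements_def)
  ultimately show ?thesis by (auto simp: star_def)
qed

text \<open>A splitting star determines its orientation, as the down-closure of the star.\<close>

lemma splitting_star_sides:
  assumes "splitting_star S \<sigma>" "x \<in> seps S"
  shows "(\<exists>s\<in>\<sigma>. x \<preceq> s) \<longleftrightarrow> \<not> (\<exists>s\<in>\<sigma>. bar x \<preceq> s)"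
proof -
  obtain Or where O: "orientation S Or" "consistent S Or" "\<sigma> = maximal_elements S Or"
    "\<And>r. r \<in> Or \<Longrightarrow> \<exists>s\<in>\<sigma>. r \<preceq> s"
    using assms by (auto simp: splitting_star_def)
  have O1: "x \<in> Or \<longleftrightarrow> bar x \<notin> Or" if "x \<in> seps S" for x
  proof -
    have "\<exists>!r. r \<in> Or \<and> r \<in> {x, bar x}"
      using O(1) that by (auto simp: orientation_def unoriented_def)
    moreover have "x \<noteq> bar x" using that le_refl not_le_bar by metis
    ultimately show ?thesis by blast
  qed
  have "y \<in> Or \<longleftrightarrow> (\<exists>s\<in>\<sigma>. y \<preceq> s)" if y: "y \<in> seps S" for y
  proof
    assume "\<exists>s\<in>\<sigma>. y \<preceq> s"
    then obtain s where s: "s \<in> Or" "y \<preceq> s" using O by (auto simp: maximal_elements_def)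
    \<comment> \<open>A consistent orientation is down-closed: if \<open>bar y\<close> were chosen
      instead, then \<open>bar y\<close> and \<open>s\<close> would violate consistency.\<close>
    show "y \<in> Or"
    proof (rule ccontr)
      assume n: "y \<notin> Or"
      then have "bar y \<in> Or" using O1 y by blast
      moreover have "unoriented S (bar y) \<noteq> unoriented S s"
        using n s y not_le_bar by (auto simp: unoriented_def doubleton_eq_iff)
      ultimately show False using O(2) s y by (force simp: consistent_def)
    qed
  qed (use O in auto)
  then show ?thesis using O1 assms(2) bar_in by metis
qed

text \<open>If \<open>s\<close> and \<open>t\<close> differed, \<open>s \<preceq> bar t\<close>
  would put \<open>x\<close> below both orientations of \<open>t\<close>.\<close>

lemma star_unique:
  assumes "star S \<sigma>" "s \<in> \<sigma>" "t \<in> \<sigma>" "x \<preceq> s" "x \<preceq> t"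
  shows "s = t"
  using assms not_le_both le_trans unfolding star_def by metis

subsection \<open>The quotient at a splitting star\<close>

text \<open>The quotient map to \<open>star_sys\<close>. For a splitting star,
  \<open>splitting_star_sides\<close> says that exactly one orientation of \<open>x\<close> lies
  below the star, and \<open>star_unique\<close> makes both descriptions well-defined.\<close>

definition side :: "'a set \<Rightarrow> 'a \<Rightarrow> bool \<times> 'a" where
  "side \<sigma> x = (if \<exists>s\<in>\<sigma>. x \<preceq> s then (True, THE s. s \<in> \<sigma> \<and> x \<preceq> s)
               else (False, THE s. s \<in> \<sigma> \<and> bar x \<preceq> s))"

lemma side_True:
  assumes "splitting_star S \<sigma>" "x \<preceq> s" "s \<in> \<sigma>"
  shows "side \<sigma> x = (True, s)"
proof -
  have "(THE s. s \<in> \<sigma> \<and> x \<preceq> s) = s"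
    using star_unique[OF splitting_star_star] assms by (intro the_equality) blast+
  then show ?thesis using assms by (auto simp: side_def)
qed

lemma side_False:
  assumes "splitting_star S \<sigma>" "bar x \<preceq> s" "s \<in> \<sigma>" "x \<in> seps S"
  shows "side \<sigma> x = (False, s)"
proof -
  have "(THE s. s \<in> \<sigma> \<and> bar x \<preceq> s) = s"
    using star_unique[OF splitting_star_star] assms by (intro the_equality) blast+
  moreover have "\<not> (\<exists>s\<in>\<sigma>. x \<preceq> s)"
    using splitting_star_sides assms by blast
  ultimately show ?thesis by (simp add: side_def)
qed

lemma side_cases:
  assumes "splitting_star S \<sigma>" "x \<in> seps S"
  obtains s where "s \<in> \<sigma>" "x \<preceq> s" "side \<sigma> x = (True, s)"
  | s where "s \<in> \<sigma>" "bar x \<preceq> s" "side \<sigma> x = (False, s)"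
proof (cases "\<exists>s\<in>\<sigma>. x \<preceq> s")
  case True
  then show thesis using that side_True assms by blast
next
  case False
  then have "\<exists>s\<in>\<sigma>. bar x \<preceq> s" using splitting_star_sides assms by blast
  then show thesis using that side_False assms by blast
qed

text \<open>If \<open>x \<preceq> y\<close> and \<open>y\<close> lies below a star element, then so
  does \<open>x\<close>, below the same one; dually for the inverses. So the star element can change
  only on passing from \<open>True\<close> to \<open>False\<close>, as the order of
  \<open>star_sys\<close> allows.\<close>

lemma homomorphism_side:
  assumes \<sigma>: "splitting_star S \<sigma>"
  shows "homomorphism S (star_sys \<sigma>) (side \<sigma>)"
  unfolding homomorphism_def
proof (intro conjI ballI impI funcsetI)
  fix x assume x: "x \<in> seps S"
  show "side \<sigma> x \<in> seps (star_sys \<sigma>)"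
    using side_cases[OF \<sigma> x] by (cases) (auto simp: star_sys_def)
  show "side \<sigma> (bar x) = flip (star_sys \<sigma>) (side \<sigma> x)"
    using \<sigma> x
  proof (cases rule: side_cases)
    case (1 s)
    then have "side \<sigma> (bar x) = (False, s)" using side_False[OF \<sigma>, of "bar x"] x by simp
    with 1 show ?thesis by (simp add: star_sys_def)
  next
    case (2 s)
    then have "side \<sigma> (bar x) = (True, s)" using side_True[OF \<sigma>] by blast
    with 2 show ?thesis by (simp add: star_sys_def)
  qed
next
  fix x y assume x: "x \<in> seps S" and y: "y \<in> seps S" and xy: "x \<preceq> y"
  show "(side \<sigma> x, side \<sigma> y) \<in> le (star_sys \<sigma>)"
    using \<sigma> x
  proof (cases rule: side_cases)
    case x1: (1 s)
    show ?thesis using \<sigma> y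
    proof (cases rule: side_cases)
      case (1 t)
      then have "side \<sigma> x = (True, t)" using side_True \<sigma> le_trans xy by blast
      then show ?thesis using 1 by (simp add: star_sys_def)
    next
      case (2 t)
      then show ?thesis using x1 by (simp add: star_sys_def)
    qed
  next
    case (2 s)
    then have "side \<sigma> y = (False, s)"
      using side_False \<sigma> y le_trans bar_le[OF xy] by blast
    then show ?thesis using 2 by (simp add: star_sys_def)
  qed
qed

section \<open>Separating the elements by splitting stars\<close>

text \<open>Such an \<open>m\<close> is a leaf: maximality turns each nested case into an
  orientation of \<open>s\<close> below \<open>m\<close>, so the down-set of \<open>m\<close> is an
  orientation.\<close>

lemma maximal_splitting_star:
  assumes m: "m \<in> seps S" "\<And>a. m \<preceq> a \<Longrightarrow> a = m"
  shows "splitting_star S {m}"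
proof -
  let ?O = "{z. z \<preceq> m}"
  have one: "s \<preceq> m \<or> bar s \<preceq> m" if s: "s \<in> seps S" for s
    using s m(1)
  proof (cases rule: nested_cases)
    case 3
    then have "bar s = m" using bar_le_right m by blast
    then show ?thesis using le_refl m by blast
  qed (use le_refl m in blast)+
  have "\<exists>!r. r \<in> ?O \<and> r \<in> {s, bar s}" if "s \<in> seps S" for s
    using one[OF that] not_both_le by blast
  then have "orientation S ?O"
    unfolding orientation_def unoriented_def using le_in by blast
  moreover have "consistent S ?O"
    unfolding consistent_def using le_trans not_both_le by blast
  moreover have "{m} = maximal_elements S ?O"
    using m le_refl by (auto simp: maximal_elements_def sless_def)
  ultimately show ?thesis unfolding splitting_star_def by blast
qed

text \<open>Beyond unfolding splittability, this records that the star elements \<open>r\<close> and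
  \<open>bar s\<close> differ, since otherwise \<open>bar s \<preceq> s\<close>. That is needed to
  tell two values of \<open>side\<close> with the same Boolean apart.\<close>

lemma split_gap:
  assumes "splittable S" "x \<preceq> y" "x \<noteq> y"
  obtains \<sigma> r s where "splitting_star S \<sigma>" "r \<in> \<sigma>" "bar s \<in> \<sigma>"
    "x \<preceq> r" "r \<preceq> s" "r \<noteq> s" "r \<noteq> bar s" "s \<preceq> y"
proof -
  have "lneqq S x y" "x \<in> seps S" "y \<in> seps S" using assms lneqq_iff le_in by auto
  then obtain r s \<sigma> where *: "x \<preceq> r" "lneqq S r s" "s \<preceq> y" "splitting_star S \<sigma>" "r \<in> \<sigma>" "bar s \<in> \<sigma>"
    using assms(1) unfolding splittable_def by blast
  moreover have "r \<preceq> s" "r \<noteq> s" using * lneqq_iff by auto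
  moreover have "r \<noteq> bar s" using \<open>r \<preceq> s\<close> not_bar_le by blast
  ultimately show thesis using that by blast
qed

text \<open>If \<open>x \<preceq> y\<close> fails, one of the other nested cases gives a gap between
  orientations of \<open>x\<close> and \<open>y\<close>. A splitting star in that gap sends
  \<open>x\<close> and \<open>y\<close> to values in the wrong order or to incomparable
  ones.\<close>

lemma side_reflects_le:
  assumes cc: "chain_complete S" and sp: "splittable S"
    and xy: "x \<in> seps S" "y \<in> seps S"
    and le: "\<And>\<sigma>. splitting_star S \<sigma> \<Longrightarrow> (side \<sigma> x, side \<sigma> y) \<in> le (star_sys \<sigma>)"
  shows "x \<preceq> y"
proof (rule ccontr)
  assume n: "\<not> x \<preceq> y"
  \<comment> \<open>Inverse separations leave no gap to split; here the leaf star at a maximal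
    \<open>m\<close> above \<open>y\<close> distinguishes them.\<close>
  have neq: "x \<noteq> bar y"
  proof
    assume "x = bar y"
    then have bx: "bar x = y" using xy by simp
    obtain m where m: "y \<preceq> m" "\<And>a. m \<preceq> a \<Longrightarrow> a = m"
      using ex_maximal[OF cc xy(2)] by blast
    have "m \<in> seps S" using m(1) le_in by blast
    then have \<sigma>: "splitting_star S {m}" using maximal_splitting_star m(2) by blast
    have "side {m} x = (False, m)" "side {m} y = (True, m)"
      using side_False[OF \<sigma>, of x m] side_True[OF \<sigma>, of y m] m(1) bx xy by auto
    then show False using le[OF \<sigma>] by (simp add: star_sys_def)
  qed
  show False using xy
  proof (cases rule: nested_cases)
    case 1
    then show False using n by blast
  next
    case 2
    then have "y \<noteq> x" using n by auto
    then obtain \<sigma> r s where *: "splitting_star S \<sigma>" "r \<in> \<sigma>" "bar s \<in> \<sigma>" "y \<preceq> r" "s \<preceq> x"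
      using split_gap[OF sp 2] by metis
    then have "side \<sigma> y = (True, r)" "side \<sigma> x = (False, bar s)"
      using side_True side_False bar_le xy by blast+
    then show False using le[OF *(1)] by (simp add: star_sys_def)
  next
    case 3
    then have "y \<preceq> bar x" "y \<noteq> bar x" using neq bar_le_right xy by auto
    then obtain \<sigma> r s where *: "splitting_star S \<sigma>" "r \<in> \<sigma>" "bar s \<in> \<sigma>" "y \<preceq> r" "s \<preceq> bar x" "r \<noteq> bar s"
      using split_gap[OF sp] by metis
    then have "side \<sigma> y = (True, r)" "side \<sigma> x = (True, bar s)"
      using side_True bar_le_right xy by blast+
    then show False using le[OF *(1)] *(6) by (simp add: star_sys_def)
  next
    case 4
    then have "bar x \<noteq> y" using neq xy by auto
    then obtain \<sigma> r s where *: "splitting_star S \<sigma>" "r \<in> \<sigma>" "bar s \<in> \<sigma>" "bar x \<preceq> r" "s \<preceq> y" "r \<noteq> bar s"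
      using split_gap[OF sp 4] by metis
    then have "side \<sigma> x = (False, r)" "side \<sigma> y = (False, bar s)"
      using side_False bar_le xy by blast+
    then show False using le[OF *(1)] *(6) by (simp add: star_sys_def)
  qed
qed

section \<open>Compactness for splitting stars\<close>

text \<open>The minimal elements form a star, so there are only finitely many; one of them lies below
  every finite subset of \<open>A\<close>, hence below \<open>A\<close>.\<close>

lemma lower_bound_compact:
  assumes cc: "chain_complete S" and sf: "star_finite S"
    and fin: "\<And>F. F \<subseteq> A \<Longrightarrow> finite F \<Longrightarrow> \<exists>y\<in>seps S. \<forall>a\<in>F. y \<preceq> a"
  shows "\<exists>x\<in>seps S. \<forall>a\<in>A. x \<preceq> a"
proof (rule ccontr)
  assume n: "\<not> ?thesis"
  define M where "M = {z \<in> seps S. \<forall>a. a \<preceq> z \<longrightarrow> a = z}"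
  have "r \<preceq> bar s" if rs: "r \<in> M" "s \<in> M" "r \<noteq> s" for r s
  proof -
    have S: "r \<in> seps S" "s \<in> seps S" using rs by (auto simp: M_def)
    then show ?thesis
    proof (cases rule: nested_cases)
      case 4
      then have "bar r = s" using rs by (auto simp: M_def)
      then have "r = bar s" using S by auto
      then show ?thesis using le_refl S by simp
    qed (use rs in \<open>auto simp: M_def\<close>)
  qed
  then have "star S M" by (auto simp: star_def M_def)
  then have "finite M" using sf by (auto simp: star_finite_def)
  have "\<forall>z\<in>M. \<exists>a\<in>A. \<not> z \<preceq> a" using n by (auto simp: M_def)
  \<comment> \<open>Each minimal \<open>z\<close> gets a witness \<open>g z\<close> in
    \<open>A\<close> that it is not below. As \<open>M\<close> is finite, the witnesses have a
    common lower bound \<open>y\<close>, and a minimal element below \<open>y\<close> is a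
    contradiction.\<close>
  then obtain g where g: "\<And>z. z \<in> M \<Longrightarrow> g z \<in> A" "\<And>z. z \<in> M \<Longrightarrow> \<not> z \<preceq> g z" by metis
  have "\<exists>y\<in>seps S. \<forall>a\<in>g ` M. y \<preceq> a"
    by (rule fin) (use g \<open>finite M\<close> in auto)
  then obtain y where y: "y \<in> seps S" "\<And>z. z \<in> M \<Longrightarrow> y \<preceq> g z" by blast
  \<comment> \<open>The minimal element below \<open>y\<close> is \<open>bar m\<close>, for a
    maximal \<open>m\<close> above \<open>bar y\<close>.\<close>
  obtain m where m: "bar y \<preceq> m" "\<And>a. m \<preceq> a \<Longrightarrow> a = m"
    using ex_maximal[OF cc bar_in[OF y(1)]] by blast
  have mS: "m \<in> seps S" using m(1) le_in by blast
  have "a = bar m" if "a \<preceq> bar m" for a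
  proof -
    have "a \<in> seps S" "m \<preceq> bar a" using that bar_le_right[OF mS] le_in by auto
    then show ?thesis using m(2) by fastforce
  qed
  then have "bar m \<in> M" using mS by (simp add: M_def)
  moreover have "bar m \<preceq> y" using m(1) bar_le_left y(1) by blast
  ultimately show False using g(2) y(2) le_trans by blast
qed

lemma upper_bound_compact:
  assumes cc: "chain_complete S" and sf: "star_finite S" and "A \<subseteq> seps S"
    and fin: "\<And>F. F \<subseteq> A \<Longrightarrow> finite F \<Longrightarrow> \<exists>y\<in>seps S. \<forall>a\<in>F. a \<preceq> y"
  shows "\<exists>x\<in>seps S. \<forall>a\<in>A. a \<preceq> x"
proof -
  have "\<exists>x\<in>seps S. \<forall>a\<in>bar ` A. x \<preceq> a"
  proof (rule lower_bound_compact[OF cc sf])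
    fix F assume "F \<subseteq> bar ` A" "finite F"
    then obtain G where G: "G \<subseteq> A" "finite G" "F = bar ` G"
      by (meson finite_subset_image)
    then obtain y where "y \<in> seps S" "\<forall>a\<in>G. a \<preceq> y" using fin by blast
    then show "\<exists>y\<in>seps S. \<forall>a\<in>F. y \<preceq> a"
      using bar_le G(3) by (intro bexI[of _ "bar y"]) auto
  qed
  then obtain x where "x \<in> seps S" "\<And>a. a \<in> A \<Longrightarrow> x \<preceq> bar a" by blast
  then show ?thesis
    using bar_le_right assms(3) by (intro bexI[of _ "bar x"]) auto
qed

text \<open>A value \<open>(True, s)\<close> prescribes the upper bound \<open>s\<close>, and
  \<open>(False, s)\<close> the lower bound \<open>bar s\<close>. Solving for \<open>x\<close> thus
  means lying between \<open>B\<close> and \<open>A\<close>.\<close>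

lemma side_compact:
  assumes cc: "chain_complete S" and sp: "splittable S" and sf: "star_finite S"
    and fip: "\<And>J. J \<subseteq> {\<sigma>. splitting_star S \<sigma>} \<Longrightarrow> finite J \<Longrightarrow> \<exists>x\<in>seps S. \<forall>\<sigma>\<in>J. side \<sigma> x = d \<sigma>"
  shows "\<exists>x\<in>seps S. \<forall>\<sigma>\<in>{\<sigma>. splitting_star S \<sigma>}. side \<sigma> x = d \<sigma>"
proof -
  define A where "A = {s. \<exists>\<sigma>. splitting_star S \<sigma> \<and> d \<sigma> = (True, s)}"
  define B where "B = {bar s | s. \<exists>\<sigma>. splitting_star S \<sigma> \<and> d \<sigma> = (False, s)}"
  have d: "(\<exists>s\<in>\<sigma>. d \<sigma> = (True, s)) \<or> (\<exists>s\<in>\<sigma>. d \<sigma> = (False, s))" if \<sigma>: "splitting_star S \<sigma>" for \<sigma>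
  proof -
    obtain y where "y \<in> seps S" "side \<sigma> y = d \<sigma>" using fip[of "{\<sigma>}"] \<sigma> by auto
    then show ?thesis using side_cases[OF \<sigma>] by metis
  qed
  have \<sigma>S: "\<sigma> \<subseteq> seps S" if "splitting_star S \<sigma>" for \<sigma>
    using splitting_star_star[OF that] by (simp add: star_def)
  have BS: "B \<subseteq> seps S"
    using d \<sigma>S by (fastforce simp: B_def)
  have True_le: "y \<preceq> s" if "splitting_star S \<sigma>" "y \<in> seps S" "side \<sigma> y = (True, s)" for \<sigma> y s
    using side_cases[OF that(1,2)] that(3) by (metis prod.inject)
  have False_le: "bar s \<preceq> y" if "splitting_star S \<sigma>" "y \<in> seps S" "side \<sigma> y = (False, s)" for \<sigma> y s
  proof -
    have "bar y \<preceq> s" using side_cases[OF that(1,2)] that(3) by (metis prod.inject)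
    then show ?thesis using bar_le_left that by blast
  qed
  have sol: ?thesis if x: "x \<in> seps S" "\<And>a. a \<in> A \<Longrightarrow> x \<preceq> a" "\<And>b. b \<in> B \<Longrightarrow> b \<preceq> x" for x
  proof -
    have "side \<sigma> x = d \<sigma>" if \<sigma>: "splitting_star S \<sigma>" for \<sigma>
      using d[OF \<sigma>]
    proof (elim disjE bexE)
      fix s assume s: "s \<in> \<sigma>" "d \<sigma> = (True, s)"
      then have "x \<preceq> s" using x(2) \<sigma> by (auto simp: A_def)
      then show ?thesis using side_True \<sigma> s by simp
    next
      fix s assume s: "s \<in> \<sigma>" "d \<sigma> = (False, s)"
      then have "bar s \<preceq> x" using x(3) \<sigma> by (auto simp: B_def)
      then have "bar x \<preceq> s" using bar_le_left \<sigma>S \<sigma> s by blast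
      then show ?thesis using side_False \<sigma> s x by simp
    qed
    then show ?thesis using x(1) by blast
  qed
  \<comment> \<open>Every bound is imposed by some splitting star, so finitely many bounds and the
    prescribed values on a finite \<open>J\<close> are realised together.\<close>
  have fin: "\<exists>y\<in>seps S. (\<forall>a\<in>F. y \<preceq> a) \<and> (\<forall>b\<in>G. b \<preceq> y) \<and> (\<forall>\<sigma>\<in>J. side \<sigma> y = d \<sigma>)"
    if F: "F \<subseteq> A" "finite F" and G: "G \<subseteq> B" "finite G"
      and J: "J \<subseteq> {\<sigma>. splitting_star S \<sigma>}" "finite J" for F G J
  proof -
    have "\<forall>a\<in>F. \<exists>\<sigma>. splitting_star S \<sigma> \<and> d \<sigma> = (True, a)" using F by (auto simp: A_def)
    then obtain g where g: "\<And>a. a \<in> F \<Longrightarrow> splitting_star S (g a) \<and> d (g a) = (True, a)" by metis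
    have "\<forall>b\<in>G. \<exists>\<sigma> s. b = bar s \<and> splitting_star S \<sigma> \<and> d \<sigma> = (False, s)"
      using G unfolding B_def by blast
    then obtain k t where k: "\<And>b. b \<in> G \<Longrightarrow> b = bar (t b) \<and> splitting_star S (k b) \<and> d (k b) = (False, t b)"
      by metis
    have "\<exists>y\<in>seps S. \<forall>\<sigma>\<in>g ` F \<union> k ` G \<union> J. side \<sigma> y = d \<sigma>"
      by (rule fip) (use F G J g k in auto)
    then obtain y where y: "y \<in> seps S" "\<forall>\<sigma>\<in>g ` F \<union> k ` G \<union> J. side \<sigma> y = d \<sigma>" by blast
    have "y \<preceq> a" if "a \<in> F" for a
      using True_le[of "g a" y a] g[OF that] y that by simp
    moreover have "b \<preceq> y" if "b \<in> G" for b
      using False_le[of "k b" y "t b"] k[OF that] y that by auto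
    ultimately show ?thesis using y by blast
  qed
  have finA: "\<exists>y\<in>seps S. \<forall>a\<in>F. y \<preceq> a" if "F \<subseteq> A" "finite F" for F
    using fin[of F "{}" "{}"] that by auto
  have finB: "\<exists>y\<in>seps S. \<forall>a\<in>F. a \<preceq> y" if "F \<subseteq> B" "finite F" for F
    using fin[of "{}" F "{}"] that by auto
  consider "B = {}" | "A = {}" | a b where "a \<in> A" "b \<in> B" by blast
  then show ?thesis
  proof cases
    case 1
    then show ?thesis using lower_bound_compact[OF cc sf finA] sol by blast
  next
    case 2
    then show ?thesis using upper_bound_compact[OF cc sf BS finB] sol by blast
  next
    case (3 a\<^sub>0 b\<^sub>0)
    \<comment> \<open>\<open>A\<close> and \<open>B\<close> need not be chains. Any two elements of
      \<open>A0\<close> have a common lower bound as well as the upper bound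
      \<open>a\<^sub>0\<close>, so \<open>interval_comparable\<close> applies; dually for
      \<open>B0\<close>.\<close>
    define A0 where "A0 = {a \<in> A. a \<preceq> a\<^sub>0}"
    define B0 where "B0 = {b \<in> B. b\<^sub>0 \<preceq> b}"
    have BA: "b \<preceq> a" if "a \<in> A" "b \<in> B" for a b
      using fin[of "{a}" "{b}" "{}"] that le_trans by auto
    have S: "a\<^sub>0 \<in> seps S" "b\<^sub>0 \<in> seps S" using BA[OF 3] le_in by auto
    have chB: "B0 \<in> Chains (le S)"
    proof -
      have "b \<preceq> c \<or> c \<preceq> b" if bc: "b \<in> B0" "c \<in> B0" for b c
      proof -
        obtain y where "b \<preceq> y" "c \<preceq> y" using finB[of "{b, c}"] bc by (auto simp: B0_def)
        then show ?thesis using interval_comparable bc by (auto simp: B0_def)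
      qed
      then show ?thesis by (simp add: Chains_def)
    qed
    have chA: "A0 \<in> Chains (le S)"
    proof -
      have "b \<preceq> c \<or> c \<preceq> b" if bc: "b \<in> A0" "c \<in> A0" for b c
      proof -
        obtain y where "y \<preceq> b" "y \<preceq> c" using finA[of "{b, c}"] bc by (auto simp: A0_def)
        then show ?thesis using interval_comparable bc by (auto simp: A0_def)
      qed
      then show ?thesis by (simp add: Chains_def)
    qed
    have b0: "b\<^sub>0 \<in> B0" using 3 S le_refl by (simp add: B0_def)
    have a0: "a\<^sub>0 \<in> A0" using 3 S le_refl by (simp add: A0_def)
    have "B0 \<subseteq> seps S" using BS by (auto simp: B0_def)
    then obtain m where m: "m \<in> seps S" "\<And>b. b \<in> B0 \<Longrightarrow> b \<preceq> m"
      "\<And>v. v \<in> seps S \<Longrightarrow> (\<And>b. b \<in> B0 \<Longrightarrow> b \<preceq> v) \<Longrightarrow> m \<preceq> v"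
      using chain_completeD[OF cc _ chB] b0 by (metis empty_iff)
    have "A0 \<subseteq> seps S" unfolding A0_def using le_in by blast
    then obtain n where n: "n \<in> seps S" "\<And>a. a \<in> A0 \<Longrightarrow> n \<preceq> a"
      "\<And>v. v \<in> seps S \<Longrightarrow> (\<And>a. a \<in> A0 \<Longrightarrow> v \<preceq> a) \<Longrightarrow> v \<preceq> n"
      using chain_complete_inf[OF cc _ chA] a0 by (metis empty_iff)
    \<comment> \<open>The extremal properties give bounds for all of \<open>A\<close> and
      \<open>B\<close>, not just \<open>A0\<close> and \<open>B0\<close>: \<open>m\<close> lies
      below \<open>A\<close> and \<open>n\<close> above \<open>B\<close>. Hence \<open>m = n\<close>
      solves the problem.\<close>
    have mA: "m \<preceq> a" if "a \<in> A" for a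
    proof (rule m(3))
      show "a \<in> seps S" using BA[OF that 3(2)] le_in by blast
    qed (use BA[OF that] in \<open>simp add: B0_def\<close>)
    have nB: "b \<preceq> n" if "b \<in> B" for b
    proof (rule n(3))
      show "b \<in> seps S" using that BS by blast
    qed (use BA[OF _ that] in \<open>simp add: A0_def\<close>)
    have mn: "m \<preceq> n"
      by (rule n(3)) (use mA m(1) in \<open>simp_all add: A0_def\<close>)
    have "m = n"
    proof (rule ccontr)
      assume "m \<noteq> n"
      then obtain \<sigma> r s where \<sigma>: "splitting_star S \<sigma>" "r \<in> \<sigma>" "bar s \<in> \<sigma>"
        and rs: "m \<preceq> r" "r \<preceq> s" "r \<noteq> s" "s \<preceq> n"
        using split_gap[OF sp mn] by metis
      have st: "star S \<sigma>" using splitting_star_star \<sigma>(1) .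
      \<comment> \<open>Lying between \<open>b\<^sub>0\<close> and \<open>a\<^sub>0\<close> pins
        down the star element belonging to \<open>y\<close>: it is \<open>r\<close> if
        \<open>y\<close> points towards the star, and \<open>bar s\<close> otherwise. Then
        \<open>r\<close> is in \<open>A0\<close> or \<open>s\<close> is in \<open>B0\<close>,
        although both lie between \<open>m\<close> and \<open>n\<close>.\<close>
      obtain y where y: "y \<in> seps S" "y \<preceq> a\<^sub>0" "b\<^sub>0 \<preceq> y" "side \<sigma> y = d \<sigma>"
        using fin[of "{a\<^sub>0}" "{b\<^sub>0}" "{\<sigma>}"] 3 \<sigma>(1) by auto
      have sS: "s \<in> seps S" using rs le_in by blast
      have br: "b\<^sub>0 \<preceq> r" using m(2)[OF b0] rs(1) le_trans by blast
      have sa: "s \<preceq> a\<^sub>0" using n(2)[OF a0] rs(4) le_trans by blast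
      show False using \<sigma>(1) y(1)
      proof (cases rule: side_cases)
        case (1 c)
        then have "c = r" using star_unique[OF st _ \<sigma>(2) _ br] y(3) le_trans by blast
        then have "r \<in> A" using 1(3) y(4) \<sigma>(1) by (auto simp: A_def)
        then have "r \<in> A0" using sa rs(2) le_trans by (auto simp: A0_def)
        then have "s \<preceq> r" using n(2) rs(4) le_trans by blast
        then show False using rs le_antisym by blast
      next
        case (2 c)
        have "bar a\<^sub>0 \<preceq> c" using 2(2) bar_le[OF y(2)] le_trans by blast
        then have "c = bar s" using star_unique[OF st 2(1) \<sigma>(3)] bar_le[OF sa] by blast
        then have "d \<sigma> = (False, bar s)" using 2(3) y(4) by simp
        then have "bar (bar s) \<in> B" unfolding B_def using \<sigma>(1) by blast
        then have "s \<in> B" using sS by simp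
        then have "s \<in> B0" using br rs(2) le_trans by (auto simp: B0_def)
        then have "s \<preceq> r" using m(2) rs(1) le_trans by blast
        then show False using rs le_antisym by blast
      qed
    qed
    then show ?thesis using sol[OF m(1) mA] nB by blast
  qed
qed

lemma profinite_if_complete_splittable:
  assumes "chain_complete S" "splittable S" "star_finite S"
  shows "profinite S"
proof (rule profinite_if_separating[where I = "{\<sigma>. splitting_star S \<sigma>}" and D = star_sys and h = side])
  fix \<sigma> assume "\<sigma> \<in> {\<sigma>. splitting_star S \<sigma>}"
  then have \<sigma>: "splitting_star S \<sigma>" by simp
  then have "finite \<sigma>" using splitting_star_star assms(3) by (auto simp: star_finite_def)
  then show "finite (seps (star_sys \<sigma>))" by (simp add: star_sys_def)
  show "homomorphism S (star_sys \<sigma>) (side \<sigma>)" using homomorphism_side \<sigma> by blast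
next
  fix x y assume "x \<in> seps S" "y \<in> seps S"
    "\<forall>\<sigma>\<in>{\<sigma>. splitting_star S \<sigma>}. (side \<sigma> x, side \<sigma> y) \<in> le (star_sys \<sigma>)"
  then show "x \<preceq> y" using side_reflects_le[OF assms(1,2)] by blast
next
  fix d assume "\<And>J. J \<subseteq> {\<sigma>. splitting_star S \<sigma>} \<Longrightarrow> finite J \<Longrightarrow> \<exists>x\<in>seps S. \<forall>\<sigma>\<in>J. side \<sigma> x = d \<sigma>"
  then show "\<exists>x\<in>seps S. \<forall>\<sigma>\<in>{\<sigma>. splitting_star S \<sigma>}. side \<sigma> x = d \<sigma>"
    by (rule side_compact[OF assms])
qed (use sep separation_system_star_sys in auto)

end

section \<open>Profinite tree sets\<close>

text \<open>An isomorphism to the inverse limit, read coordinatewise: \<open>h p\<close> is its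
  coordinate at \<open>p\<close>, \<open>h_le\<close> contains the embedding and
  \<open>h_surj\<close> the surjectivity.\<close>

locale profinite_tree_set = regular_tree_set S for S :: "'a sepsys" +
  fixes P :: "'i set" and R and D :: "'i \<Rightarrow> 'e sepsys" and f and h :: "'i \<Rightarrow> 'a \<Rightarrow> 'e"
  assumes sys: "finite_inverse_system P R D f"
    and h_in: "\<And>p x. p \<in> P \<Longrightarrow> x \<in> seps S \<Longrightarrow> h p x \<in> seps (D p)"
    and h_bar: "\<And>p x. p \<in> P \<Longrightarrow> x \<in> seps S \<Longrightarrow> h p (bar x) = flip (D p) (h p x)"
    and h_le: "\<And>x y. x \<in> seps S \<Longrightarrow> y \<in> seps S \<Longrightarrow> x \<preceq> y \<longleftrightarrow> (\<forall>p\<in>P. (h p x, h p y) \<in> le (D p))"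
    and f_h: "\<And>p q x. (p, q) \<in> R \<Longrightarrow> x \<in> seps S \<Longrightarrow> f q p (h q x) = h p x"
    and h_surj: "\<And>d. d \<in> compatible_families P R D f \<Longrightarrow> \<exists>x\<in>seps S. \<forall>p\<in>P. h p x = d p"
begin

lemma R_in: "(p, q) \<in> R \<Longrightarrow> p \<in> P" "(p, q) \<in> R \<Longrightarrow> q \<in> P"
  using sys by (auto simp: finite_inverse_system_def directed_poset_def partial_order_on_def preorder_on_def)

lemma D_po: "p \<in> P \<Longrightarrow> partial_order_on (seps (D p)) (le (D p))"
  using sys by (auto simp: finite_inverse_system_def separation_system_def)

lemma D_refl: "p \<in> P \<Longrightarrow> a \<in> seps (D p) \<Longrightarrow> (a, a) \<in> le (D p)"
  and D_antisym: "p \<in> P \<Longrightarrow> (a, b) \<in> le (D p) \<Longrightarrow> (b, a) \<in> le (D p) \<Longrightarrow> a = b"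
  and D_trans: "p \<in> P \<Longrightarrow> trans (le (D p))"
  using D_po by (auto simp: partial_order_on_def preorder_on_def refl_on_def antisym_def)

lemma f_hom: "(p, q) \<in> R \<Longrightarrow> homomorphism (D q) (D p) (f q p)"
  using sys by (auto simp: finite_inverse_system_def)

lemma h_mono: "p \<in> P \<Longrightarrow> x \<preceq> y \<Longrightarrow> (h p x, h p y) \<in> le (D p)"
  using h_le le_in by blast

text \<open>Frees \<open>h_surj\<close> from extensionality: values of \<open>d\<close> outside
  \<open>P\<close> may be arbitrary.\<close>

lemma h_surj':
  assumes "\<And>p. p \<in> P \<Longrightarrow> d p \<in> seps (D p)" "\<And>p q. (p, q) \<in> R \<Longrightarrow> f q p (d q) = d p"
  shows "\<exists>x\<in>seps S. \<forall>p\<in>P. h p x = d p"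
proof -
  have "restrict d P \<in> compatible_families P R D f"
    using assms R_in by (auto simp: compatible_families_def)
  from h_surj[OF this] show ?thesis by simp
qed

section \<open>Chain-completeness\<close>

text \<open>The greatest images of the chain in the finite \<open>D p\<close> are compatible and so
  define the supremum. That each coordinate is attained by a chain member keeps suprema inside sets
  defined by a condition on one coordinate.\<close>

lemma chain_sup:
  assumes C: "C \<subseteq> seps S" "C \<in> Chains (le S)" "C \<noteq> {}"
  obtains u where "is_supremum S C u" "\<And>p. p \<in> P \<Longrightarrow> \<exists>c\<in>C. h p u = h p c"
proof -
  have "\<exists>c\<in>C. \<forall>c'\<in>C. (h p c', h p c) \<in> le (D p)" if p: "p \<in> P" for p
  proof -
    have "\<exists>m\<in>h p ` C. \<forall>a\<in>h p ` C. (a, m) \<in> le (D p)"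
    proof (rule finite_chain_greatest)
      have "h p ` C \<subseteq> seps (D p)" using h_in p C(1) by auto
      moreover have "finite (seps (D p))" using sys p by (auto simp: finite_inverse_system_def)
      ultimately show "finite (h p ` C)" by (rule finite_subset)
      show "(a, b) \<in> le (D p) \<or> (b, a) \<in> le (D p)" if "a \<in> h p ` C" "b \<in> h p ` C" for a b
        using that C(2) h_mono[OF p] unfolding Chains_def by blast
    qed (use C(3) D_trans p in auto)
    then show ?thesis by blast
  qed
  then obtain g where g: "\<And>p. p \<in> P \<Longrightarrow> g p \<in> C"
    "\<And>p c. p \<in> P \<Longrightarrow> c \<in> C \<Longrightarrow> (h p c, h p (g p)) \<in> le (D p)" by metis
  have gS: "g p \<in> seps S" if "p \<in> P" for p using g(1) C(1) that by blast
  have "\<exists>u\<in>seps S. \<forall>p\<in>P. h p u = h p (g p)"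
  proof (rule h_surj')
    fix p q assume pq: "(p, q) \<in> R"
    have P: "p \<in> P" "q \<in> P" using R_in pq by auto
    \<comment> \<open>Compatibility: the greatest image at \<open>q\<close>, pushed down to
      \<open>p\<close>, dominates the image of \<open>g p\<close>, which is already greatest at
      \<open>p\<close>.\<close>
    have "(h q (g p), h q (g q)) \<in> le (D q)" using g P by blast
    then have "(f q p (h q (g p)), f q p (h q (g q))) \<in> le (D p)"
      using f_hom[OF pq] h_in[OF P(2)] gS P by (simp add: homomorphism_def)
    then have "(h p (g p), h p (g q)) \<in> le (D p)" using f_h[OF pq] gS P by simp
    moreover have "(h p (g q), h p (g p)) \<in> le (D p)" using g P by blast
    ultimately have "h p (g q) = h p (g p)" using D_antisym P by blast
    then show "f q p (h q (g q)) = h p (g p)" using f_h[OF pq] gS P by simp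
  qed (use h_in gS in blast)
  then obtain u where u: "u \<in> seps S" "\<And>p. p \<in> P \<Longrightarrow> h p u = h p (g p)" by blast
  have "c \<preceq> u" if "c \<in> C" for c
    using h_le[of c u] u g(2) that C(1) by (simp add: subset_iff)
  moreover have "u \<preceq> v" if v: "v \<in> seps S" "\<And>c. c \<in> C \<Longrightarrow> c \<preceq> v" for v
    using h_le[of u v] u v h_mono g(1) by simp
  ultimately have "is_supremum S C u" using u(1) by (simp add: is_supremum_def)
  then show thesis using that u(2) g(1) by blast
qed

lemma chain_complete: "chain_complete S"
  unfolding chain_complete_def using chain_sup by metis

section \<open>Covering pairs and splittability\<close>

text \<open>Some coordinate \<open>p\<close> separates \<open>s\<close> from \<open>r\<close>. Take
  \<open>r'\<close> greatest in the interval with the image of \<open>r\<close> at \<open>p\<close>,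
  and \<open>s'\<close> least above \<open>r'\<close> with a different image; any \<open>w\<close>
  between them has one kind of image or the other.\<close>

lemma ex_covering_pair:
  assumes "r \<preceq> s" "r \<noteq> s"
  obtains r' s' where "r \<preceq> r'" "r' \<preceq> s'" "r' \<noteq> s'" "s' \<preceq> s"
    "\<And>w. r' \<preceq> w \<Longrightarrow> w \<preceq> s' \<Longrightarrow> w = r' \<or> w = s'"
proof -
  have S: "r \<in> seps S" "s \<in> seps S" using assms le_in by auto
  have "\<not> s \<preceq> r" using assms le_antisym by blast
  then obtain p where p: "p \<in> P" "(h p s, h p r) \<notin> le (D p)" using h_le S by blast
  define W where "W = {w. r \<preceq> w \<and> w \<preceq> s \<and> h p w = h p r}"
  have WS: "W \<subseteq> seps S" using le_in by (auto simp: W_def)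
  have W: "W \<in> Chains (le S)" unfolding W_def Chains_def using interval_comparable by blast
  have "r \<in> W" using assms S le_refl by (simp add: W_def)
  then obtain r' where r': "is_supremum S W r'" "\<exists>c\<in>W. h p r' = h p c"
    using chain_sup[OF WS W] p(1) by (metis empty_iff)
  have rW: "h p r' = h p r" "r \<preceq> r'" "r' \<preceq> s" "\<And>w. w \<in> W \<Longrightarrow> w \<preceq> r'"
    using r' \<open>r \<in> W\<close> S by (auto simp: W_def is_supremum_def)
  \<comment> \<open>The inverses of the elements from \<open>r'\<close> to \<open>s\<close> whose
    image differs from that of \<open>r\<close>; the least such element is \<open>bar t\<close> for
    the supremum \<open>t\<close> of \<open>V\<close>.\<close>
  define V where "V = {w. bar s \<preceq> w \<and> w \<preceq> bar r' \<and> h p w \<noteq> h p (bar r)}"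
  have VS: "V \<subseteq> seps S" using le_in by (auto simp: V_def)
  have r'S: "r' \<in> seps S" using rW le_in by blast
  have hs: "h p (bar s) \<noteq> h p (bar r)"
  proof
    assume e: "h p (bar s) = h p (bar r)"
    have "h p s = flip (D p) (h p (bar s))" using h_bar[OF p(1), of "bar s"] S by simp
    also have "\<dots> = h p r" using e h_bar[OF p(1), of "bar r"] S by simp
    finally show False using p D_refl h_in S by auto
  qed
  have V: "V \<in> Chains (le S)" unfolding V_def Chains_def using interval_comparable by blast
  have "bar s \<in> V" using rW S le_refl bar_le hs by (simp add: V_def)
  then obtain t where t: "is_supremum S V t" "\<exists>c\<in>V. h p t = h p c"
    using chain_sup[OF VS V] p(1) by (metis empty_iff)
  have tV: "h p t \<noteq> h p (bar r)" "t \<preceq> bar r'" "bar s \<preceq> t" "\<And>w. w \<in> V \<Longrightarrow> w \<preceq> t" "t \<in> seps S"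
    using t \<open>bar s \<in> V\<close> r'S by (auto simp: V_def is_supremum_def)
  show thesis
  proof
    show "r \<preceq> r'" by (fact rW)
    show "r' \<preceq> bar t" using bar_le_right tV r'S by blast
    show "r' \<noteq> bar t"
    proof
      assume "r' = bar t"
      then have "t = bar r'" using tV by simp
      then show False using tV(1) rW(1) h_bar p(1) r'S S by simp
    qed
    show "bar t \<preceq> s" using bar_le_left tV S by blast
    fix w assume w: "r' \<preceq> w" "w \<preceq> bar t"
    have wS: "w \<in> seps S" using w le_in by blast
    have rws: "r \<preceq> w" "w \<preceq> s" using w rW \<open>bar t \<preceq> s\<close> le_trans by blast+
    show "w = r' \<or> w = bar t"
    proof (cases "h p w = h p r")
      case True
      then have "w \<preceq> r'" using rW(4) rws by (simp add: W_def)
      then show ?thesis using w(1) le_antisym by blast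
    next
      case False
      have "h p (bar w) \<noteq> h p (bar r)"
      proof
        assume e: "h p (bar w) = h p (bar r)"
        have "h p w = flip (D p) (h p (bar w))" using h_bar[OF p(1), of "bar w"] wS by simp
        also have "\<dots> = h p r" using e h_bar[OF p(1), of "bar r"] S by simp
        finally show False using False by simp
      qed
      then have "bar w \<in> V" using rws w bar_le by (simp add: V_def)
      then have "bar t \<preceq> w" using tV(4) bar_le_left wS by blast
      then show ?thesis using w(2) le_antisym by blast
    qed
  qed
qed

text \<open>The vertex between \<open>r\<close> and \<open>s\<close> is the orientation obtained from the leaf orientation
  below \<open>s\<close> by reversing \<open>s\<close> itself. The covering assumption makes it closed under suprema.\<close>

lemma covering_pair_splitting_star:
  assumes rs: "r \<preceq> s" "r \<noteq> s" and cov: "\<And>w. r \<preceq> w \<Longrightarrow> w \<preceq> s \<Longrightarrow> w = r \<or> w = s"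
  obtains \<sigma> where "splitting_star S \<sigma>" "r \<in> \<sigma>" "bar s \<in> \<sigma>"
proof -
  have S: "r \<in> seps S" "s \<in> seps S" using rs le_in by auto
  define Or where "Or = {z. z \<preceq> s \<and> z \<noteq> s \<or> z \<preceq> bar s}"
  have OS: "Or \<subseteq> seps S" using le_in by (auto simp: Or_def)
  have one: "z \<in> Or \<longleftrightarrow> bar z \<notin> Or" if z: "z \<in> seps S" for z
  proof -
    have n: "\<not> (z \<preceq> s \<and> bar z \<preceq> s)" "\<not> (z \<preceq> bar s \<and> bar z \<preceq> bar s)"
      using not_both_le by blast+
    have "z \<preceq> s \<and> z \<noteq> s \<or> z \<preceq> bar s \<or> bar z \<preceq> s \<and> bar z \<noteq> s \<or> bar z \<preceq> bar s"
      using z S(2)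
    proof (cases rule: nested_cases)
      case 1
      then show ?thesis using le_refl S by (cases "z = s") auto
    next
      case 4
      then show ?thesis using le_refl S z by (cases "bar z = s") auto
    qed (use bar_le in blast)+
    moreover have "\<not> (z \<preceq> s \<and> z \<noteq> s \<and> bar z \<preceq> bar s)"
      using bar_le_iff[OF z S(2)] le_antisym by blast
    moreover have "\<not> (bar z \<preceq> s \<and> bar z \<noteq> s \<and> z \<preceq> bar s)"
      using bar_le_right[OF S(2)] le_antisym by blast
    ultimately show ?thesis using n unfolding Or_def by blast
  qed
  have "\<exists>!x. x \<in> Or \<and> x \<in> {z, bar z}" if "z \<in> seps S" for z
    using one[OF that] by blast
  then have ori: "orientation S Or"
    using OS by (simp add: orientation_def unoriented_def)
  have "consistent S Or"
    unfolding consistent_def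
  proof (rule notI, elim bexE conjE)
    fix z z' assume zO: "z \<in> Or" and z'O: "z' \<in> Or" and zz: "bar z \<preceq> z'"
      and ne: "unoriented S z \<noteq> unoriented S z'"
    have zS: "z \<in> seps S" using OS zO by blast
    have "z' \<noteq> s" using z'O not_le_bar by (auto simp: Or_def)
    \<comment> \<open>\<open>Or\<close> is down-closed, so an inconsistent pair would give both
      orientations of \<open>z\<close>.\<close>
    have "bar z \<in> Or"
    proof (cases "z' \<preceq> s")
      case True
      then have "bar z \<preceq> s" "bar z \<noteq> s"
        using zz le_trans le_antisym \<open>z' \<noteq> s\<close> by blast+
      then show ?thesis by (simp add: Or_def)
    next
      case False
      then have "bar z \<preceq> bar s" using z'O zz le_trans by (auto simp: Or_def)
      then show ?thesis by (simp add: Or_def)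
    qed
    then show False using one zO zS by blast
  qed
  moreover have "\<exists>m\<in>maximal_elements S Or. z \<preceq> m" if z: "z \<in> Or" for z
  proof -
    have "\<exists>m\<in>Or. z \<preceq> m \<and> (\<forall>a\<in>Or. m \<preceq> a \<longrightarrow> a = m)"
    proof (rule ex_maximal_above[OF OS z])
      fix C assume C: "C \<in> Chains (le S)" "z \<in> C" "C \<subseteq> Or"
      have CS: "C \<subseteq> seps S" "C \<noteq> {}" using C OS by auto
      obtain u where u: "u \<in> seps S" "\<And>c. c \<in> C \<Longrightarrow> c \<preceq> u"
        "\<And>v. v \<in> seps S \<Longrightarrow> (\<And>c. c \<in> C \<Longrightarrow> c \<preceq> v) \<Longrightarrow> u \<preceq> v"
        using chain_completeD[OF chain_complete CS(1) C(1) CS(2)] by metis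
      have Cch: "c \<preceq> c' \<or> c' \<preceq> c" if "c \<in> C" "c' \<in> C" for c c'
        using C(1) that by (auto simp: Chains_def)
      \<comment> \<open>A chain below \<open>bar s\<close> is bounded by \<open>bar s\<close>
        itself. Any other chain lies below \<open>s\<close>, and its supremum is in
        \<open>Or\<close> unless it equals \<open>s\<close>.\<close>
      show "\<exists>u\<in>Or. \<forall>c\<in>C. c \<preceq> u"
      proof (cases "\<forall>c\<in>C. c \<preceq> bar s")
        case True
        then show ?thesis using le_refl S by (intro bexI[of _ "bar s"]) (auto simp: Or_def)
      next
        case False
        then obtain c0 where c0: "c0 \<in> C" "\<not> c0 \<preceq> bar s" by blast
        have below: "c \<preceq> s" if "c \<in> C" for c
        proof (rule ccontr)
          assume n: "\<not> c \<preceq> s"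
          then have c: "c \<preceq> bar s" using that C(3) by (auto simp: Or_def)
          have c0s: "c0 \<preceq> s" using c0 C(3) by (auto simp: Or_def)
          show False using Cch[OF that c0(1)]
          proof
            assume "c \<preceq> c0"
            then show False using n c0s le_trans by blast
          next
            assume "c0 \<preceq> c"
            then show False using c c0(2) le_trans by blast
          qed
        qed
        have us: "u \<preceq> s" using u(3)[OF S(2)] below by blast
        \<comment> \<open>If \<open>s\<close> were the supremum, some \<open>c1\<close> would not
          lie below \<open>r\<close>. From \<open>c1\<close> upwards, the covering assumption and
          nestedness leave only elements below \<open>bar r\<close>, so \<open>bar r\<close> bounds
          the chain; then \<open>r \<preceq> s \<preceq> bar r\<close>.\<close>
        have "u \<noteq> s"
        proof
          assume "u = s"
          have "\<not> (\<forall>c\<in>C. c \<preceq> r)"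
            using u(3)[OF S(1)] \<open>u = s\<close> rs le_antisym by blast
          then obtain c1 where c1: "c1 \<in> C" "\<not> c1 \<preceq> r" by blast
          have up: "c \<preceq> bar r" if c: "c \<in> C" "c1 \<preceq> c" for c
          proof -
            have cS: "c \<in> seps S" using c le_in by blast
            show ?thesis using cS S(1)
            proof (cases rule: nested_cases)
              case 1
              then show ?thesis using c1(2) c(2) le_trans by blast
            next
              case 2
              then have "c = r \<or> c = s" using cov below c(1) by blast
              moreover have "c \<noteq> r" using c1(2) c(2) by blast
              moreover have "c \<noteq> s" using c(1) C(3) not_le_bar by (auto simp: Or_def)
              ultimately show ?thesis by blast
            next
              case 4
              then have "bar c \<preceq> s" using rs(1) le_trans by blast
              then show ?thesis using below[OF c(1)] not_both_le by blast
            qed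
          qed
          have c1r: "c1 \<preceq> bar r" using up[OF c1(1)] le_refl CS(1) c1(1) by blast
          have "c \<preceq> bar r" if "c \<in> C" for c
            using Cch[OF that c1(1)]
          proof
            assume "c \<preceq> c1"
            then show ?thesis using c1r by (rule le_trans)
          qed (use up that in blast)
          then have "u \<preceq> bar r" by (rule u(3)[OF bar_in[OF S(1)]])
          then have "s \<preceq> bar r" using \<open>u = s\<close> by simp
          then show False using rs(1) le_trans not_le_bar by blast
        qed
        then show ?thesis using us u(2) by (intro bexI[of _ u]) (auto simp: Or_def)
      qed
    qed
    then show ?thesis unfolding maximal_elements_def sless_def by blast
  qed
  ultimately have "splitting_star S (maximal_elements S Or)"
    using ori unfolding splitting_star_def by blast
  moreover have "r \<in> maximal_elements S Or"
  proof -
    have "r \<in> Or" using rs by (simp add: Or_def)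
    moreover have False if z: "z \<in> Or" "r \<preceq> z" "r \<noteq> z" for z
    proof (cases "z \<preceq> bar s")
      case True
      then show False using z(2) rs(1) le_trans not_le_both by blast
    next
      case False
      then show False using z cov by (auto simp: Or_def)
    qed
    ultimately show ?thesis by (auto simp: maximal_elements_def sless_def)
  qed
  moreover have "bar s \<in> maximal_elements S Or"
  proof -
    have "bar s \<in> Or" using le_refl S by (simp add: Or_def)
    moreover have False if z: "z \<in> Or" "bar s \<preceq> z" "bar s \<noteq> z" for z
    proof (cases "z \<preceq> bar s")
      case True
      then show False using z le_antisym by blast
    next
      case False
      then have "bar s \<preceq> s" using z le_trans by (auto simp: Or_def)
      then show False using not_bar_le by blast
    qed
    ultimately show ?thesis by (auto simp: maximal_elements_def sless_def)
  qed
  ultimately show thesis using that by blast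
qed

lemma splittable: "splittable S"
  unfolding splittable_def
proof (intro ballI impI)
  fix r s assume "lneqq S r s"
  then have "r \<preceq> s" "r \<noteq> s" by (auto simp: lneqq_iff)
  then obtain r' s' where p: "r \<preceq> r'" "r' \<preceq> s'" "r' \<noteq> s'" "s' \<preceq> s"
    and cov: "\<And>w. r' \<preceq> w \<Longrightarrow> w \<preceq> s' \<Longrightarrow> w = r' \<or> w = s'"
    using ex_covering_pair by metis
  obtain \<sigma> where "splitting_star S \<sigma>" "r' \<in> \<sigma>" "bar s' \<in> \<sigma>"
    using covering_pair_splitting_star[OF p(2,3) cov] by blast
  then show "\<exists>r'\<in>seps S. \<exists>s'\<in>seps S. r \<preceq> r' \<and> lneqq S r' s' \<and> s' \<preceq> s \<and>
      (\<exists>\<sigma>. splitting_star S \<sigma> \<and> r' \<in> \<sigma> \<and> bar s' \<in> \<sigma>)"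
    using p le_in lneqq_iff by blast
qed

section \<open>Star-finiteness\<close>

text \<open>Two elements of an infinite star agree in any given finite quotient, where their common image
  is then small; by compactness \<open>S\<close> itself would contain a small element.\<close>

lemma star_finite: "star_finite S"
  unfolding star_finite_def
proof safe
  fix \<sigma> assume st: "star S \<sigma>" and inf: "infinite \<sigma>"
  have \<sigma>S: "\<sigma> \<subseteq> seps S" using st by (simp add: star_def)
  let ?X = "product_topology (\<lambda>p. discrete_topology (seps (D p))) P"
  \<comment> \<open>Points of the product that are compatible below \<open>q\<close> and small at
    \<open>q\<close>. These sets shrink as \<open>q\<close> grows, and a point in all of them is a
    small element of the inverse limit.\<close>
  define K where "K q = {x \<in> topspace ?X. (\<forall>p. (p, q) \<in> R \<longrightarrow> x p = f q p (x q)) \<and>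
    (x q, flip (D q) (x q)) \<in> le (D q)}" for q
  have fin: "finite (seps (D p))" if "p \<in> P" for p
    using sys that by (auto simp: finite_inverse_system_def)
  have cpt: "compact_space ?X"
    using fin by (simp add: compact_space_product_topology compact_space_discrete_topology)
  \<comment> \<open>A condition on two coordinates is the preimage of a subset of a discrete space,
    hence closed; \<open>K q\<close> is an intersection of such sets.\<close>
  have clopen: "closedin ?X {x \<in> topspace ?X. (x p, x q) \<in> U}" if "p \<in> P" "q \<in> P" for p q U
  proof -
    let ?Y = "prod_topology (discrete_topology (seps (D p))) (discrete_topology (seps (D q)))"
    have "continuous_map ?X ?Y (\<lambda>x. (x p, x q))"
      using that by (intro continuous_map_pairedI continuous_map_product_projection)
    moreover have "closedin ?Y (U \<inter> seps (D p) \<times> seps (D q))"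
      by (simp flip: prod_topology_discrete_topology)
    ultimately have "closedin ?X {x \<in> topspace ?X. (x p, x q) \<in> U \<inter> seps (D p) \<times> seps (D q)}"
      by (rule closedin_continuous_map_preimage)
    moreover have "{x \<in> topspace ?X. (x p, x q) \<in> U \<inter> seps (D p) \<times> seps (D q)}
      = {x \<in> topspace ?X. (x p, x q) \<in> U}"
      using that by (auto simp: PiE_def Pi_def)
    ultimately show ?thesis by simp
  qed
  have Kcl: "closedin ?X (K q)" if q: "q \<in> P" for q
  proof -
    have "K q = {x \<in> topspace ?X. (x q, x q) \<in> {(a, b). (a, flip (D q) b) \<in> le (D q)}} \<inter>
      \<Inter> ((\<lambda>p. {x \<in> topspace ?X. (x p, x q) \<in> {(a, b). a = f q p b}}) ` {p. (p, q) \<in> R})"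
      (is "_ = ?A \<inter> \<Inter> ?F")
      by (auto simp: K_def)
    moreover have "closedin ?X (\<Inter> ?F)"
    proof (rule closedin_Inter)
      have "(q, q) \<in> R"
        using sys q by (auto simp: finite_inverse_system_def directed_poset_def
            partial_order_on_def preorder_on_def refl_on_def)
      then show "?F \<noteq> {}" by blast
    qed (use clopen R_in in blast)
    ultimately show ?thesis using clopen[OF q q] by (simp only: closedin_Int)
  qed
  have Kne: "K q \<noteq> {}" if q: "q \<in> P" for q
  proof -
    have "h q ` \<sigma> \<subseteq> seps (D q)" using h_in q \<sigma>S by blast
    then have "finite (h q ` \<sigma>)" using fin[OF q] finite_subset by blast
    then have "\<not> inj_on (h q) \<sigma>" using inf finite_imageD by blast
    then obtain r s where rs: "r \<in> \<sigma>" "s \<in> \<sigma>" "r \<noteq> s" "h q r = h q s" by (auto simp: inj_on_def)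
    have S: "r \<in> seps S" "s \<in> seps S" using rs \<sigma>S by auto
    have "r \<preceq> bar s" using rs st by (auto simp: star_def)
    then have "(h q r, flip (D q) (h q r)) \<in> le (D q)"
      using h_mono[OF q] h_bar[OF q S(2)] rs(4) by metis
    moreover have "(\<lambda>p\<in>P. h p r) \<in> topspace ?X" using h_in S by auto
    ultimately have "(\<lambda>p\<in>P. h p r) \<in> K q"
      using f_h S R_in q by (auto simp: K_def)
    then show ?thesis by blast
  qed
  have Kmono: "K t \<subseteq> K q" if qt: "(q, t) \<in> R" for q t
  proof
    fix x assume x: "x \<in> K t"
    have P: "q \<in> P" "t \<in> P" using R_in qt by auto
    have xt: "x t \<in> seps (D t)" using x P by (auto simp: K_def)
    have xf: "x p = f t p (x t)" if "(p, t) \<in> R" for p using x that by (simp add: K_def)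
    have "x p = f q p (x q)" if pq: "(p, q) \<in> R" for p
    proof -
      have "(p, t) \<in> R"
        using sys pq qt unfolding finite_inverse_system_def directed_poset_def
          partial_order_on_def preorder_on_def by (meson transD)
      moreover have "f q p (f t q (x t)) = f t p (x t)"
        using sys pq qt xt unfolding finite_inverse_system_def by blast
      ultimately show ?thesis using xf qt by simp
    qed
    \<comment> \<open>Smallness at \<open>t\<close> passes to \<open>q\<close>, because the bonding
      map preserves order and involution.\<close>
    moreover have "(f t q (x t), f t q (flip (D t) (x t))) \<in> le (D q)"
    proof -
      have "separation_system (D t)" using sys P by (auto simp: finite_inverse_system_def)
      then have "flip (D t) (x t) \<in> seps (D t)" using xt by (auto simp: separation_system_def)
      then show ?thesis using f_hom[OF qt] x xt unfolding homomorphism_def K_def by blast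
    qed
    then have "(x q, flip (D q) (x q)) \<in> le (D q)"
      using f_hom[OF qt] xt xf[OF qt] by (simp add: homomorphism_def)
    ultimately show "x \<in> K q" using x by (simp add: K_def)
  qed
  have dir: "P \<noteq> {}" "\<And>p q. p \<in> P \<Longrightarrow> q \<in> P \<Longrightarrow> \<exists>t\<in>P. (p, t) \<in> R \<and> (q, t) \<in> R"
    using sys by (auto simp: finite_inverse_system_def directed_poset_def)
  \<comment> \<open>Directedness turns non-emptiness of the single sets \<open>K t\<close> into the
    finite intersection property.\<close>
  have lower: "\<exists>t\<in>P. \<forall>q\<in>F. K t \<subseteq> K q" if "finite F" "F \<subseteq> P" for F
    using that
  proof (induction rule: finite_induct)
    case empty
    then show ?case using dir(1) by blast
  next
    case (insert q F)
    then obtain t where t: "t \<in> P" "\<forall>q\<in>F. K t \<subseteq> K q" by blast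
    obtain t' where "t' \<in> P" "(q, t') \<in> R" "(t, t') \<in> R" using dir(2)[of q t] insert.prems t by blast
    then show ?case using Kmono t(2) by (intro bexI[of _ t']) blast+
  qed
  have "\<Inter> (K ` P) \<noteq> {}"
  proof (rule cpt[unfolded compact_space_fip, rule_format], intro conjI ballI allI impI)
    fix \<F> assume "finite \<F> \<and> \<F> \<subseteq> K ` P"
    then obtain F where "finite F" "F \<subseteq> P" "\<F> = K ` F" by (meson finite_subset_image)
    then show "\<Inter> \<F> \<noteq> {}" using lower[of F] Kne by blast
  qed (use Kcl in auto)
  then obtain x where x: "\<And>p. p \<in> P \<Longrightarrow> x \<in> K p" by blast
  have "\<exists>u\<in>seps S. \<forall>p\<in>P. h p u = x p"
  proof (rule h_surj')
    show "x p \<in> seps (D p)" if "p \<in> P" for p using x[OF that] that by (auto simp: K_def)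
    show "f q p (x q) = x p" if "(p, q) \<in> R" for p q
      using x[OF R_in(2)[OF that]] that by (simp add: K_def)
  qed
  then obtain u where u: "u \<in> seps S" "\<And>p. p \<in> P \<Longrightarrow> h p u = x p" by blast
  have "(h p u, h p (bar u)) \<in> le (D p)" if "p \<in> P" for p
    using x[OF that] u h_bar that by (simp add: K_def)
  then have "u \<preceq> bar u" using h_le u(1) by simp
  then show False using not_le_bar by blast
qed

end

section \<open>Coordinates of an isomorphism, and the equivalence\<close>

lemma profinite_tree_setI:
  assumes S: "tree_set S" "regular S" and sys: "finite_inverse_system P R D f"
    and iso: "isomorphism S (inverse_limit P R D f) \<phi>"
  shows "profinite_tree_set S P R D f (\<lambda>p x. \<phi> x p)"
proof -
  interpret regular_tree_set S using S by unfold_locales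
  let ?L = "inverse_limit P R D f"
  have L: "seps ?L = compatible_families P R D f" by (simp add: inverse_limit_def)
  have bij: "bij_betw \<phi> (seps S) (compatible_families P R D f)"
    using iso by (simp add: isomorphism_def L)
  have \<phi>L: "\<phi> x \<in> compatible_families P R D f" if "x \<in> seps S" for x
    using bij that by (auto simp: bij_betw_def)
  show ?thesis
  proof unfold_locales
    fix x y assume xy: "x \<in> seps S" "y \<in> seps S"
    have "x \<preceq> y \<longleftrightarrow> (\<phi> x, \<phi> y) \<in> le ?L"
    proof
      assume "(\<phi> x, \<phi> y) \<in> le ?L"
      moreover have "homomorphism ?L S (inv_into (seps S) \<phi>)" using iso by (simp add: isomorphism_def)
      ultimately have "inv_into (seps S) \<phi> (\<phi> x) \<preceq> inv_into (seps S) \<phi> (\<phi> y)"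
        using \<phi>L xy by (simp add: homomorphism_def L)
      then show "x \<preceq> y" using bij xy by (simp add: bij_betw_def inv_into_f_f)
    qed (use iso xy in \<open>simp add: isomorphism_def homomorphism_def\<close>)
    also have "\<dots> \<longleftrightarrow> (\<forall>p\<in>P. (\<phi> x p, \<phi> y p) \<in> le (D p))"
      using \<phi>L xy by (simp add: inverse_limit_def)
    finally show "x \<preceq> y \<longleftrightarrow> (\<forall>p\<in>P. (\<phi> x p, \<phi> y p) \<in> le (D p))" .
  next
    fix p x assume "p \<in> P" "x \<in> seps S"
    then show "\<phi> x p \<in> seps (D p)" using \<phi>L[of x] by (auto simp: compatible_families_def)
    show "\<phi> (bar x) p = flip (D p) (\<phi> x p)"
      using iso \<open>p \<in> P\<close> \<open>x \<in> seps S\<close> by (simp add: isomorphism_def homomorphism_def inverse_limit_def)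
  next
    fix p q x assume "(p, q) \<in> R" "x \<in> seps S"
    then show "f q p (\<phi> x q) = \<phi> x p" using \<phi>L[of x] by (auto simp: compatible_families_def)
  next
    fix d assume "d \<in> compatible_families P R D f"
    then obtain x where "x \<in> seps S" "\<phi> x = d" using bij unfolding bij_betw_def by (metis imageE)
    then show "\<exists>x\<in>seps S. \<forall>p\<in>P. \<phi> x p = d p" by blast
  qed (fact sys)
qed

theorem theorem3p29:
  fixes \<tau> :: "'a sepsys"
  assumes "tree_set \<tau>" and "regular \<tau>"
  shows "profinite \<tau> \<longleftrightarrow> chain_complete \<tau> \<and> splittable \<tau> \<and> star_finite \<tau>"
proof
  assume "profinite \<tau>"
  then obtain P :: "('a \<times> 'a) set set" and R and D :: "('a \<times> 'a) set \<Rightarrow> nat sepsys" and f \<phi>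
    where "finite_inverse_system P R D f" "isomorphism \<tau> (inverse_limit P R D f) \<phi>"
    unfolding profinite_def isomorphic_def by blast
  then interpret profinite_tree_set \<tau> P R D f "\<lambda>p x. \<phi> x p"
    using profinite_tree_setI[OF assms] by blast
  show "chain_complete \<tau> \<and> splittable \<tau> \<and> star_finite \<tau>"
    using chain_complete splittable star_finite by blast
next
  interpret regular_tree_set \<tau> using assms by unfold_locales
  assume "chain_complete \<tau> \<and> splittable \<tau> \<and> star_finite \<tau>"
  then show "profinite \<tau>" using profinite_if_complete_splittable by blast
qed

end
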